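(* The synthesis problem for flat, non-strict global window $L$-PCTL formulae is $\mathsf{coRE}$-hard: deciding, given a finite MDP $M$ and a global window formula $\forall G\,\Phi$ with $\Phi$ flat and non-strict, whether there exists a strategy $\sigma$ with $M[\sigma]\models\forall G\,\Phi$, is $\mathsf{coRE}$-hard.
   Context: A Markov chain (MC) is a tuple $(S,s_{\mathrm{init}},P,AP,L)$ with $S$ a countable set of states, $s_{\mathrm{init}}\in S$, $P:S\to\mathrm{Dist}(S)$, $AP$ a nonempty finite set of atomic propositions, $L:S\to 2^{AP}$; it induces the standard probability measure $\mu$ on infinite paths from each state. A Markov decision process (MDP) is $M=(S,A,s_{\mathrm{init}},P,AP,L)$ with $S$ finite, $A$ a finite set of actions, $P:S\times A\to\mathrm{Dist}(S)$ with rational probabilities in binary (every action available in every state). A finite path is $s_0a_0s_1\cdots s_i$ with $P(s_j,a_j,s_{j+1})>0$. A strategy $\sigma$ maps finite paths to distributions over $A$ (randomisation and unbounded memory allowed). $M[\sigma]$ is the MC whose states are finite paths of $M$, initial state $s_{\mathrm{init}}$, transitions $\rho\to\rho a s$ with probability $\sigma(\rho)(a)P(\mathrm{last}(\rho),a,s)$, labels $L(\mathrm{last}(\rho))$. $L$-PCTL: state formulae $\Phi::=p\mid\neg p\mid\Phi_1\wedge\Phi_2\mid\Phi_1\vee\Phi_2\mid\sum_{i=1}^n c_i\mathbb P(\varphi_i)\succcurlyeq c_0$ with $p\in AP$, $n\ge1$, $c_i\in\mathbb Z$, ${\succcurlyeq}\in\{\ge,>\}$; path formulae $\varphi::=X^\ell\Phi\mid\Phi_1U^\ell\Phi_2\mid\Phi_1W^\ell\Phi_2\mid\Phi_1U^\infty\Phi_2\mid\Phi_1W^\infty\Phi_2$,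 $\ell\in\mathbb N$. An infinite path $s_0s_1\cdots$ satisfies $X^\ell\Phi$ iff $s_\ell\models\Phi$; $\Phi_1U^\ell\Phi_2$ iff some $j\le\ell$ has $s_j\models\Phi_2$ and $s_i\models\Phi_1$ for all $i<j$; $\Phi_1W^\ell\Phi_2$ iff for every $j\le\ell$, $s_j\models\Phi_1$ or $s_j\models\Phi_2$ or some $i<j$ has $s_i\models\Phi_2$; $\infty$ versions let $j$ range over $\mathbb N$. A state $s$ satisfies $\sum c_i\mathbb P(\varphi_i)\succcurlyeq c_0$ iff $\sum c_i\,\mu(\{\text{paths from } s\text{ satisfying }\varphi_i\})\succcurlyeq c_0$; atomic and Boolean cases as usual. $\Phi$ is a window formula if all horizon labels are finite; non-strict if $\succcurlyeq$ is always $\ge$; flat if no $\mathbb P$ operator occurs inside the argument of another $\mathbb P$ operator. A global window formula is $\forall G\,\Phi$ with $\Phi$ a window formula; a state satisfies it iff every state reachable from it satisfies $\Phi$; an MC satisfies it if its initial state does. *)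

theory Defs
  imports "HOL-Probability.Probability" "HOL-Library.Nat_Bijection" "HOL-Library.Extended_Nat"
begin

section \<open>Computability\<close>

datatype recf = Zero | Succ | Proj nat | Comp recf "recf list" | PrimRec recf recf | Mu recf

text \<open>Kleene's partial recursive functions; \<open>reval f xs y\<close> means that \<open>f\<close> is defined on the
  argument list \<open>xs\<close> with value \<open>y\<close>.\<close>

inductive reval :: "recf \<Rightarrow> nat list \<Rightarrow> nat \<Rightarrow> bool" where
  Zero: "reval Zero xs 0"
| Succ: "reval Succ [x] (Suc x)"
| Proj: "i < length xs \<Longrightarrow> reval (Proj i) xs (xs ! i)"
| Comp: "length ys = length gs \<Longrightarrow> (\<And>i. i < length gs \<Longrightarrow> reval (gs ! i) xs (ys ! i)) \<Longrightarrow>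
    reval f ys z \<Longrightarrow> reval (Comp f gs) xs z"
| PrimRec_0: "reval f xs y \<Longrightarrow> reval (PrimRec f g) (0 # xs) y"
| PrimRec_Suc: "reval (PrimRec f g) (n # xs) y \<Longrightarrow> reval g (n # y # xs) z \<Longrightarrow>
    reval (PrimRec f g) (Suc n # xs) z"
| Mu: "reval f (n # xs) 0 \<Longrightarrow> (\<And>i. i < n \<Longrightarrow> \<exists>y. reval f (i # xs) (Suc y)) \<Longrightarrow>
    reval (Mu f) xs n"

definition total_computable :: "(nat \<Rightarrow> nat) \<Rightarrow> bool" where
  "total_computable h \<longleftrightarrow> (\<exists>f. \<forall>x. reval f [x] (h x))"

definition RE :: "nat set \<Rightarrow> bool" where
  "RE A \<longleftrightarrow> (\<exists>f. A = {x. \<exists>y. reval f [x] y})"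

definition coRE :: "nat set \<Rightarrow> bool" where
  "coRE A \<longleftrightarrow> RE (- A)"

definition many_one_reducible :: "nat set \<Rightarrow> nat set \<Rightarrow> bool" where
  "many_one_reducible A B \<longleftrightarrow> (\<exists>h. total_computable h \<and> (\<forall>x. x \<in> A \<longleftrightarrow> h x \<in> B))"

definition coRE_hard :: "nat set \<Rightarrow> bool" where
  "coRE_hard B \<longleftrightarrow> (\<forall>A. coRE A \<longrightarrow> many_one_reducible A B)"

lemma reval_functional: "reval f xs y \<Longrightarrow> reval f xs y' \<Longrightarrow> y = y'"
proof (induction arbitrary: y' rule: reval.induct)
  case (Zero xs) then show ?case by (cases rule: reval.cases) auto
next
  case (Succ x) then show ?case by (cases rule: reval.cases) auto
next
  case (Proj i xs) from Proj.prems show ?case by (cases rule: reval.cases) auto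
next
  case (PrimRec_0 f xs y g) from PrimRec_0.prems show ?case by (cases rule: reval.cases) (auto intro: PrimRec_0.IH)
next
  case (Comp ys gs xs f z)
  from Comp.prems obtain ys' where ys': "length ys' = length gs"
    "\<And>i. i < length gs \<Longrightarrow> reval (gs ! i) xs (ys' ! i)" "reval f ys' y'"
    by (cases rule: reval.cases) auto
  have "ys = ys'"
    using Comp.hyps(1) Comp.IH(1) ys' by (intro nth_equalityI) auto
  with Comp.IH ys' show ?case by auto
next
  case (PrimRec_Suc f g n xs y z)
  from PrimRec_Suc.prems obtain u where "reval (PrimRec f g) (n # xs) u" "reval g (n # u # xs) y'"
    by (cases rule: reval.cases) auto
  with PrimRec_Suc.IH show ?case by metis
next
  case (Mu f n xs)
  from Mu.prems have "reval f (y' # xs) 0 \<and> (\<forall>i<y'. \<exists>y. reval f (i # xs) (Suc y))"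
    by (cases rule: reval.cases) auto
  then have w: "reval f (y' # xs) 0" "\<And>i. i < y' \<Longrightarrow> \<exists>y. reval f (i # xs) (Suc y)"
    by auto
  show ?case
  proof (rule linorder_cases[of n y'])
    assume "n < y'" with w(2) Mu.IH(1) show ?thesis by fastforce
  next
    assume "y' < n" with w(1) Mu.IH(2) show ?thesis by fastforce
  qed
qed


section \<open>Markov chains and their path measure\<close>

record ('s, 'p) mc =
  mc_states :: "'s set"
  mc_init :: 's
  mc_trans :: "'s \<Rightarrow> 's pmf"
  mc_AP :: "'p set"
  mc_label :: "'s \<Rightarrow> 'p set"

definition markov_chain :: "('s, 'p) mc \<Rightarrow> bool" where
  "markov_chain C \<longleftrightarrow>
     countable (mc_states C) \<and> mc_init C \<in> mc_states C \<and>
     (\<forall>s\<in>mc_states C. set_pmf (mc_trans C s) \<subseteq> mc_states C) \<and>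
     finite (mc_AP C) \<and> mc_AP C \<noteq> {} \<and> (\<forall>s\<in>mc_states C. mc_label C s \<subseteq> mc_AP C)"

text \<open>An infinite path is a function \<open>\<omega> :: nat \<Rightarrow> 's\<close>. The conditional law of \<open>\<omega> n\<close>
  given \<open>\<omega> 0, \<dots>, \<omega> (n - 1)\<close> is a point mass for \<open>n = 0\<close> and \<open>K (\<omega> (n - 1))\<close> otherwise; the
  path measure is the measure on the product \<open>\<sigma>\<close>-algebra obtained from these by the
  Ionescu-Tulcea extension theorem.\<close>

definition path_step :: "('s \<Rightarrow> 's pmf) \<Rightarrow> 's \<Rightarrow> nat \<Rightarrow> (nat \<Rightarrow> 's) \<Rightarrow> 's measure" where
  "path_step K s n \<omega> = measure_pmf (case n of 0 \<Rightarrow> return_pmf s | Suc m \<Rightarrow> K (\<omega> m))"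

definition path_measure :: "('s \<Rightarrow> 's pmf) \<Rightarrow> 's \<Rightarrow> (nat \<Rightarrow> 's) measure" where
  "path_measure K s =
     projective_family.lim UNIV
       (Ionescu_Tulcea.CI (path_step K s) (\<lambda>_. count_space UNIV)) (\<lambda>_. count_space UNIV)"

lemma Ionescu_Tulcea_path_step: "Ionescu_Tulcea (path_step K s) (\<lambda>_. count_space UNIV)"
proof (rule Ionescu_Tulcea.intro)
  fix i
  show "path_step K s i \<in> measurable (PiM {0..<i} (\<lambda>_. count_space UNIV)) (subprob_algebra (count_space UNIV))"
  proof (cases i)
    case 0
    then show ?thesis
      by (auto simp: path_step_def[abs_def] space_subprob_algebra
          intro!: measurable_const prob_space_imp_subprob_space prob_space_measure_pmf)
  next
    case (Suc m)
    have "(\<lambda>\<omega>. \<omega> m) \<in> measurable (PiM {0..<i} (\<lambda>_. count_space UNIV)) (count_space UNIV)"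
      using Suc by (intro measurable_component_singleton) auto
    moreover have "(\<lambda>x. measure_pmf (K x)) \<in> measurable (count_space UNIV) (subprob_algebra (count_space UNIV))"
      by (auto simp: space_subprob_algebra intro!: prob_space_imp_subprob_space prob_space_measure_pmf)
    ultimately have "(\<lambda>x. measure_pmf (K x)) \<circ> (\<lambda>\<omega>. \<omega> m) \<in> measurable (PiM {0..<i} (\<lambda>_. count_space UNIV)) (subprob_algebra (count_space UNIV))"
      by (rule measurable_comp)
    with Suc show ?thesis
      by (simp add: path_step_def[abs_def] comp_def)
  qed
qed (simp add: path_step_def prob_space_measure_pmf)

interpretation path: Ionescu_Tulcea "path_step K s" "\<lambda>_. count_space UNIV" for K s
  by (rule Ionescu_Tulcea_path_step)

lemma space_path_measure [simp]: "space (path_measure K s) = UNIV"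
  by (simp add: path_measure_def space_PiM)

lemma sets_path_measure [measurable_cong]:
  "sets (path_measure K s) = sets (PiM UNIV (\<lambda>_. count_space UNIV))"
  by (simp add: path_measure_def)

lemma emeasure_path_measure_cylinder:
  "emeasure (path_measure K s) {\<omega>. \<forall>i\<le>n. \<omega> i = x i} =
     (if x 0 = s then \<Prod>i<n. ennreal (pmf (K (x i)) (x (Suc i))) else 0)"
proof -
  let ?M = "\<lambda>_::nat. count_space (UNIV :: 'a set)"
  have single: "{restrict x J} \<in> sets (PiM J ?M)" if "finite J" for J :: "nat set"
  proof -
    have "{restrict x J} = (\<Pi>\<^sub>E i\<in>J. {x i})"
      by (auto simp: PiE_iff extensional_def fun_eq_iff)
    with that show ?thesis by (auto intro!: sets_PiM_I_finite)
  qed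
  have C: "emeasure (path.C K s 0 n (\<lambda>_. undefined)) {restrict x {0..<n}} =
      (\<Prod>i<n. ennreal (pmf (case i of 0 \<Rightarrow> return_pmf s | Suc m \<Rightarrow> K (x m)) (x i)))" for n
  proof (induction n)
    case 0
    have "(\<lambda>_. undefined) \<in> space (PiM {0..<0} ?M)" "restrict x {} = (\<lambda>_. undefined)"
      by (auto simp: space_PiM)
    then show ?case using single[of "{}"] by simp
  next
    case (Suc n)
    let ?C = "path.C K s 0 n (\<lambda>_. undefined)"
    let ?p = "pmf (case n of 0 \<Rightarrow> return_pmf s | Suc m \<Rightarrow> K (x m)) (x n)"
    have sp: "(\<lambda>_. undefined) \<in> space (PiM {0..<0} ?M)" by (simp add: space_PiM)
    have spC: "space ?C = space (PiM {0..<n} ?M)"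
      using path.space_C[OF sp, of K s n] by simp
    have setsC: "sets ?C = sets (PiM {0..<n} ?M)"
      using path.sets_C[OF sp, of K s n] by simp
    have ne: "space ?C \<noteq> {}" by (auto simp: spC space_PiM PiE_eq_empty_iff)
    have eP: "emeasure (path.eP K s n \<omega>) {restrict x {0..<Suc n}} =
        ennreal ?p * indicator {restrict x {0..<n}} \<omega>" if \<omega>: "\<omega> \<in> space ?C" for \<omega>
    proof -
      have ext: "\<omega> \<in> extensional {0..<n}" using \<omega> by (auto simp: spC space_PiM PiE_def)
      have "emeasure (path.eP K s n \<omega>) {restrict x {0..<Suc n}} =
          emeasure (path_step K s n \<omega>) (fun_upd \<omega> n -` {restrict x {0..<Suc n}})"
        using \<omega> by (subst path.emeasure_eP) (auto simp: spC intro!: single)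
      also have "fun_upd \<omega> n -` {restrict x {0..<Suc n}} =
          (if \<omega> = restrict x {0..<n} then {x n} else {})"
      proof -
        have "fun_upd \<omega> n y = restrict x {0..<Suc n} \<longleftrightarrow> \<omega> = restrict x {0..<n} \<and> y = x n" for y
          using ext by (auto simp: fun_eq_iff extensional_def less_Suc_eq split: if_splits)
        then show ?thesis by auto
      qed
      also have "emeasure (path_step K s n \<omega>) \<dots> = ennreal ?p * indicator {restrict x {0..<n}} \<omega>"
        by (auto simp: path_step_def emeasure_pmf_single split: nat.split)
      finally show ?thesis .
    qed
    have "emeasure (path.C K s 0 (Suc n) (\<lambda>_. undefined)) {restrict x {0..<Suc n}} =
        (\<integral>\<^sup>+\<omega>. emeasure (path.eP K s n \<omega>) {restrict x {0..<Suc n}} \<partial>?C)"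
      using path.measurable_eP[of K s n]
      by (auto simp: measurable_cong_sets[OF setsC refl] intro!: emeasure_bind[OF ne _ single])
    also have "\<dots> = (\<integral>\<^sup>+\<omega>. ennreal ?p * indicator {restrict x {0..<n}} \<omega> \<partial>?C)"
      by (intro nn_integral_cong eP)
    also have "\<dots> = ennreal ?p * emeasure ?C {restrict x {0..<n}}"
      by (intro nn_integral_cmult_indicator) (simp add: setsC single)
    finally show ?case by (simp only: Suc.IH prod.lessThan_Suc mult.commute)
  qed
  have "{\<omega>. \<forall>i\<le>n. \<omega> i = x i} = prod_emb UNIV ?M {0..<Suc n} {restrict x {0..<Suc n}}"
    by (auto simp: prod_emb_def fun_eq_iff restrict_def less_Suc_eq_le) meson
  then have "emeasure (path_measure K s) {\<omega>. \<forall>i\<le>n. \<omega> i = x i} =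
      emeasure (path.CI K s {0..<Suc n}) {restrict x {0..<Suc n}}"
    unfolding path_measure_def using path.lim[OF _ single, of "{0..<Suc n}" K s] by simp
  also have "\<dots> = emeasure (path.C K s 0 (Suc n) (\<lambda>_. undefined)) {restrict x {0..<Suc n}}"
  proof -
    have "prod_emb {0..<Suc n} ?M {0..<Suc n} {restrict x {0..<Suc n}} = {restrict x {0..<Suc n}}"
      using sets.sets_into_space[OF single[of "{0..<Suc n}"]]
      by (intro prod_emb_id) (auto simp: space_PiM)
    then show ?thesis
      by (subst path.emeasure_CI[where n="Suc n"]) (auto intro: single simp del: path.C.simps)
  qed
  also have "\<dots> = (if x 0 = s then \<Prod>i<n. ennreal (pmf (K (x i)) (x (Suc i))) else 0)"
    by (subst C) (simp add: prod.lessThan_Suc_shift indicator_def del: prod.lessThan_Suc)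
  finally show ?thesis .
qed


section \<open>L-PCTL\<close>

datatype cmp = GE | GT

datatype (atoms: 'p) sformula =
    Atom 'p
  | NegAtom 'p
  | Conj "'p sformula" "'p sformula"
  | Disj "'p sformula" "'p sformula"
  | Prob "(int \<times> 'p pformula) list" cmp int
and (path_atoms: 'p) pformula =
    Next nat "'p sformula"
  | Until enat "'p sformula" "'p sformula"
  | WeakUntil enat "'p sformula" "'p sformula"

fun compare :: "cmp \<Rightarrow> real \<Rightarrow> real \<Rightarrow> bool" where
  "compare GE x y \<longleftrightarrow> x \<ge> y"
| "compare GT x y \<longleftrightarrow> x > y"

fun sat :: "('s, 'p) mc \<Rightarrow> 's \<Rightarrow> 'p sformula \<Rightarrow> bool"
  and psat :: "('s, 'p) mc \<Rightarrow> (nat \<Rightarrow> 's) \<Rightarrow> 'p pformula \<Rightarrow> bool" where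
  "sat C s (Atom p) \<longleftrightarrow> p \<in> mc_label C s"
| "sat C s (NegAtom p) \<longleftrightarrow> p \<notin> mc_label C s"
| "sat C s (Conj \<Phi> \<Psi>) \<longleftrightarrow> sat C s \<Phi> \<and> sat C s \<Psi>"
| "sat C s (Disj \<Phi> \<Psi>) \<longleftrightarrow> sat C s \<Phi> \<or> sat C s \<Psi>"
| "sat C s (Prob ts r c0) \<longleftrightarrow>
     compare r
       (\<Sum>(c, \<phi>)\<leftarrow>ts. real_of_int c * measure (path_measure (mc_trans C) s) {\<omega>. psat C \<omega> \<phi>})
       (real_of_int c0)"
| "psat C \<omega> (Next l \<Phi>) \<longleftrightarrow> sat C (\<omega> l) \<Phi>"
| "psat C \<omega> (Until h \<Phi> \<Psi>) \<longleftrightarrow>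
     (\<exists>j. enat j \<le> h \<and> sat C (\<omega> j) \<Psi> \<and> (\<forall>i<j. sat C (\<omega> i) \<Phi>))"
| "psat C \<omega> (WeakUntil h \<Phi> \<Psi>) \<longleftrightarrow>
     (\<forall>j. enat j \<le> h \<longrightarrow> sat C (\<omega> j) \<Phi> \<or> sat C (\<omega> j) \<Psi> \<or> (\<exists>i<j. sat C (\<omega> i) \<Psi>))"

text \<open>Every linear combination has at least one summand.\<close>

fun wf_sformula :: "'p sformula \<Rightarrow> bool" and wf_pformula :: "'p pformula \<Rightarrow> bool" where
  "wf_sformula (Atom p) \<longleftrightarrow> True"
| "wf_sformula (NegAtom p) \<longleftrightarrow> True"
| "wf_sformula (Conj \<Phi> \<Psi>) \<longleftrightarrow> wf_sformula \<Phi> \<and> wf_sformula \<Psi>"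
| "wf_sformula (Disj \<Phi> \<Psi>) \<longleftrightarrow> wf_sformula \<Phi> \<and> wf_sformula \<Psi>"
| "wf_sformula (Prob ts r c0) \<longleftrightarrow> ts \<noteq> [] \<and> (\<forall>(c, \<phi>)\<in>set ts. wf_pformula \<phi>)"
| "wf_pformula (Next l \<Phi>) \<longleftrightarrow> wf_sformula \<Phi>"
| "wf_pformula (Until h \<Phi> \<Psi>) \<longleftrightarrow> wf_sformula \<Phi> \<and> wf_sformula \<Psi>"
| "wf_pformula (WeakUntil h \<Phi> \<Psi>) \<longleftrightarrow> wf_sformula \<Phi> \<and> wf_sformula \<Psi>"

fun window :: "'p sformula \<Rightarrow> bool" and path_window :: "'p pformula \<Rightarrow> bool" where
  "window (Atom p) \<longleftrightarrow> True"
| "window (NegAtom p) \<longleftrightarrow> True"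
| "window (Conj \<Phi> \<Psi>) \<longleftrightarrow> window \<Phi> \<and> window \<Psi>"
| "window (Disj \<Phi> \<Psi>) \<longleftrightarrow> window \<Phi> \<and> window \<Psi>"
| "window (Prob ts r c0) \<longleftrightarrow> (\<forall>(c, \<phi>)\<in>set ts. path_window \<phi>)"
| "path_window (Next l \<Phi>) \<longleftrightarrow> window \<Phi>"
| "path_window (Until h \<Phi> \<Psi>) \<longleftrightarrow> h \<noteq> \<infinity> \<and> window \<Phi> \<and> window \<Psi>"
| "path_window (WeakUntil h \<Phi> \<Psi>) \<longleftrightarrow> h \<noteq> \<infinity> \<and> window \<Phi> \<and> window \<Psi>"

fun non_strict :: "'p sformula \<Rightarrow> bool" and path_non_strict :: "'p pformula \<Rightarrow> bool" where
  "non_strict (Atom p) \<longleftrightarrow> True"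
| "non_strict (NegAtom p) \<longleftrightarrow> True"
| "non_strict (Conj \<Phi> \<Psi>) \<longleftrightarrow> non_strict \<Phi> \<and> non_strict \<Psi>"
| "non_strict (Disj \<Phi> \<Psi>) \<longleftrightarrow> non_strict \<Phi> \<and> non_strict \<Psi>"
| "non_strict (Prob ts r c0) \<longleftrightarrow> r = GE \<and> (\<forall>(c, \<phi>)\<in>set ts. path_non_strict \<phi>)"
| "path_non_strict (Next l \<Phi>) \<longleftrightarrow> non_strict \<Phi>"
| "path_non_strict (Until h \<Phi> \<Psi>) \<longleftrightarrow> non_strict \<Phi> \<and> non_strict \<Psi>"
| "path_non_strict (WeakUntil h \<Phi> \<Psi>) \<longleftrightarrow> non_strict \<Phi> \<and> non_strict \<Psi>"

fun prob_free :: "'p sformula \<Rightarrow> bool" where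
  "prob_free (Atom p) \<longleftrightarrow> True"
| "prob_free (NegAtom p) \<longleftrightarrow> True"
| "prob_free (Conj \<Phi> \<Psi>) \<longleftrightarrow> prob_free \<Phi> \<and> prob_free \<Psi>"
| "prob_free (Disj \<Phi> \<Psi>) \<longleftrightarrow> prob_free \<Phi> \<and> prob_free \<Psi>"
| "prob_free (Prob ts r c0) \<longleftrightarrow> False"

fun path_prob_free :: "'p pformula \<Rightarrow> bool" where
  "path_prob_free (Next l \<Phi>) \<longleftrightarrow> prob_free \<Phi>"
| "path_prob_free (Until h \<Phi> \<Psi>) \<longleftrightarrow> prob_free \<Phi> \<and> prob_free \<Psi>"
| "path_prob_free (WeakUntil h \<Phi> \<Psi>) \<longleftrightarrow> prob_free \<Phi> \<and> prob_free \<Psi>"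

fun flat_formula :: "'p sformula \<Rightarrow> bool" where
  "flat_formula (Atom p) \<longleftrightarrow> True"
| "flat_formula (NegAtom p) \<longleftrightarrow> True"
| "flat_formula (Conj \<Phi> \<Psi>) \<longleftrightarrow> flat_formula \<Phi> \<and> flat_formula \<Psi>"
| "flat_formula (Disj \<Phi> \<Psi>) \<longleftrightarrow> flat_formula \<Phi> \<and> flat_formula \<Psi>"
| "flat_formula (Prob ts r c0) \<longleftrightarrow> (\<forall>(c, \<phi>)\<in>set ts. path_prob_free \<phi>)"

definition mc_reachable :: "('s, 'p) mc \<Rightarrow> 's \<Rightarrow> 's set" where
  "mc_reachable C s = {t. (s, t) \<in> {(u, v). pmf (mc_trans C u) v > 0}\<^sup>*}"

definition sat_AG :: "('s, 'p) mc \<Rightarrow> 's \<Rightarrow> 'p sformula \<Rightarrow> bool" where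
  "sat_AG C s \<Phi> \<longleftrightarrow> (\<forall>t\<in>mc_reachable C s. sat C t \<Phi>)"

definition mc_sat_AG :: "('s, 'p) mc \<Rightarrow> 'p sformula \<Rightarrow> bool" where
  "mc_sat_AG C \<Phi> \<longleftrightarrow> sat_AG C (mc_init C) \<Phi>"


section \<open>Markov decision processes\<close>

record ('s, 'a, 'p) mdp =
  states :: "'s set"
  actions :: "'a set"
  init :: 's
  transition :: "'s \<Rightarrow> 'a \<Rightarrow> 's pmf"
  AP :: "'p set"
  label :: "'s \<Rightarrow> 'p set"

definition markov_decision_process :: "('s, 'a, 'p) mdp \<Rightarrow> bool" where
  "markov_decision_process M \<longleftrightarrow>
     finite (states M) \<and> finite (actions M) \<and> init M \<in> states M \<and>
     (\<forall>s\<in>states M. \<forall>a\<in>actions M.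
        set_pmf (transition M s a) \<subseteq> states M \<and> (\<forall>t. pmf (transition M s a) t \<in> \<rat>)) \<and>
     finite (AP M) \<and> AP M \<noteq> {} \<and> (\<forall>s\<in>states M. label M s \<subseteq> AP M)"

text \<open>The finite path \<open>s\<^sub>0 a\<^sub>0 s\<^sub>1 \<dots> a\<^sub>i\<^sub>-\<^sub>1 s\<^sub>i\<close> is represented by
  \<open>(s\<^sub>0, [(a\<^sub>0, s\<^sub>1), \<dots>, (a\<^sub>i\<^sub>-\<^sub>1, s\<^sub>i)])\<close>.\<close>

type_synonym ('s, 'a) fpath = "'s \<times> ('a \<times> 's) list"

definition last_state :: "('s, 'a) fpath \<Rightarrow> 's" where
  "last_state \<rho> = last (fst \<rho> # map snd (snd \<rho>))"

definition extend_path :: "('s, 'a) fpath \<Rightarrow> 'a \<Rightarrow> 's \<Rightarrow> ('s, 'a) fpath" where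
  "extend_path \<rho> a s = (fst \<rho>, snd \<rho> @ [(a, s)])"

inductive_set finite_paths :: "('s, 'a, 'p) mdp \<Rightarrow> ('s, 'a) fpath set" for M where
  single: "s \<in> states M \<Longrightarrow> (s, []) \<in> finite_paths M"
| extend: "\<rho> \<in> finite_paths M \<Longrightarrow> a \<in> actions M \<Longrightarrow> s \<in> states M \<Longrightarrow>
    pmf (transition M (last_state \<rho>) a) s > 0 \<Longrightarrow> extend_path \<rho> a s \<in> finite_paths M"

type_synonym ('s, 'a) strategy = "('s, 'a) fpath \<Rightarrow> 'a pmf"

definition is_strategy :: "('s, 'a, 'p) mdp \<Rightarrow> ('s, 'a) strategy \<Rightarrow> bool" where
  "is_strategy M \<sigma> \<longleftrightarrow> (\<forall>\<rho>\<in>finite_paths M. set_pmf (\<sigma> \<rho>) \<subseteq> actions M)"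

definition induced_mc ::
    "('s, 'a, 'p) mdp \<Rightarrow> ('s, 'a) strategy \<Rightarrow> (('s, 'a) fpath, 'p) mc" where
  "induced_mc M \<sigma> =
     \<lparr>mc_states = finite_paths M,
      mc_init = (init M, []),
      mc_trans = (\<lambda>\<rho>. bind_pmf (\<sigma> \<rho>) (\<lambda>a. map_pmf (extend_path \<rho> a) (transition M (last_state \<rho>) a))),
      mc_AP = AP M,
      mc_label = (\<lambda>\<rho>. label M (last_state \<rho>))\<rparr>"

lemma last_state_extend [simp]: "last_state (extend_path \<rho> a s) = s"
  by (simp add: last_state_def extend_path_def)

lemma last_state_single [simp]: "last_state (s, []) = s"
  by (simp add: last_state_def)

lemma last_state_in_states: "\<rho> \<in> finite_paths M \<Longrightarrow> last_state \<rho> \<in> states M"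
  by (induction rule: finite_paths.induct) auto

lemma pmf_induced_mc:
  "pmf (mc_trans (induced_mc M \<sigma>) \<rho>) (extend_path \<rho> a s) = pmf (\<sigma> \<rho>) a * pmf (transition M (last_state \<rho>) a) s"
proof -
  have "pmf (map_pmf (extend_path \<rho> b) (transition M (last_state \<rho>) b)) (extend_path \<rho> a s) =
      pmf (transition M (last_state \<rho>) a) s * indicator {a} b" for b
  proof (cases "b = a")
    case True
    have "inj (extend_path \<rho> a)" by (auto simp: inj_def extend_path_def)
    with True show ?thesis by (simp add: pmf_map_inj')
  next
    case False
    then have "extend_path \<rho> a s \<notin> set_pmf (map_pmf (extend_path \<rho> b) (transition M (last_state \<rho>) b))"
      by (auto simp: extend_path_def)
    with False show ?thesis by (simp add: pmf_eq_0_set_pmf del: set_map_pmf)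
  qed
  then show ?thesis
    by (simp add: induced_mc_def pmf_bind measure_pmf_single mult.commute)
qed

lemma markov_chain_induced_mc:
  assumes "markov_decision_process M" "is_strategy M \<sigma>"
  shows "markov_chain (induced_mc M \<sigma>)"
proof -
  have fp: "finite_paths M \<subseteq> states M \<times> lists (actions M \<times> states M)"
  proof
    fix \<rho> assume "\<rho> \<in> finite_paths M"
    then show "\<rho> \<in> states M \<times> lists (actions M \<times> states M)"
      by (induction rule: finite_paths.induct) (auto simp: extend_path_def)
  qed
  have "countable (finite_paths M)"
    using assms(1) fp
    by (intro countable_subset[OF fp] countable_SIGMA countable_lists)
       (auto simp: markov_decision_process_def intro: countable_finite)
  moreover have "set_pmf (mc_trans (induced_mc M \<sigma>) \<rho>) \<subseteq> finite_paths M" if "\<rho> \<in> finite_paths M" for \<rho>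
  proof
    fix \<rho>' assume "\<rho>' \<in> set_pmf (mc_trans (induced_mc M \<sigma>) \<rho>)"
    then obtain a s where a: "a \<in> set_pmf (\<sigma> \<rho>)" and s: "s \<in> set_pmf (transition M (last_state \<rho>) a)"
      and \<rho>': "\<rho>' = extend_path \<rho> a s"
      by (auto simp: induced_mc_def)
    have "a \<in> actions M" using a assms(2) that by (auto simp: is_strategy_def)
    moreover from this have "s \<in> states M"
      using s assms(1) last_state_in_states[OF that] by (auto simp: markov_decision_process_def)
    ultimately show "\<rho>' \<in> finite_paths M"
      unfolding \<rho>' using s that by (intro finite_paths.extend) (auto simp: pmf_positive_iff)
  qed
  ultimately show ?thesis
    using assms(1) last_state_in_states[of _ M]
    unfolding markov_chain_def markov_decision_process_def
    by (simp add: induced_mc_def finite_paths.single)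
qed


section \<open>Encoding of problem instances\<close>

text \<open>Instances are coded for MDPs whose states, actions and atomic propositions are initial
  segments of the natural numbers.\<close>

definition standard_mdp :: "(nat, nat, nat) mdp \<Rightarrow> bool" where
  "standard_mdp M \<longleftrightarrow>
     markov_decision_process M \<and>
     (\<exists>n m k. states M = {..<n} \<and> actions M = {..<m} \<and> AP M = {..<k})"

definition rat_of_real :: "real \<Rightarrow> rat" where
  "rat_of_real x = (THE q. x = of_rat q)"

definition encode_rat :: "rat \<Rightarrow> nat" where
  "encode_rat q = (case quotient_of q of (a, b) \<Rightarrow> prod_encode (int_encode a, int_encode b))"

definition encode_mdp :: "(nat, nat, nat) mdp \<Rightarrow> nat" where
  "encode_mdp M =
     (let n = card (states M); m = card (actions M) in
      list_encode
        [n, m, card (AP M), init M,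
         list_encode (map (\<lambda>s. list_encode (map (\<lambda>a. list_encode (map (\<lambda>t.
           encode_rat (rat_of_real (pmf (transition M s a) t))) [0..<n])) [0..<m])) [0..<n]),
         list_encode (map (\<lambda>s. set_encode (label M s)) [0..<n])])"

fun encode_cmp :: "cmp \<Rightarrow> nat" where
  "encode_cmp GE = 0"
| "encode_cmp GT = 1"

fun encode_horizon :: "enat \<Rightarrow> nat" where
  "encode_horizon (enat l) = Suc l"
| "encode_horizon \<infinity> = 0"

fun encode_sformula :: "nat sformula \<Rightarrow> nat" and encode_pformula :: "nat pformula \<Rightarrow> nat" where
  "encode_sformula (Atom p) = list_encode [0, p]"
| "encode_sformula (NegAtom p) = list_encode [1, p]"
| "encode_sformula (Conj \<Phi> \<Psi>) = list_encode [2, encode_sformula \<Phi>, encode_sformula \<Psi>]"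
| "encode_sformula (Disj \<Phi> \<Psi>) = list_encode [3, encode_sformula \<Phi>, encode_sformula \<Psi>]"
| "encode_sformula (Prob ts r c0) =
     list_encode
       [4, list_encode (map (\<lambda>(c, \<phi>). prod_encode (int_encode c, encode_pformula \<phi>)) ts),
        encode_cmp r, int_encode c0]"
| "encode_pformula (Next l \<Phi>) = list_encode [0, l, encode_sformula \<Phi>]"
| "encode_pformula (Until h \<Phi> \<Psi>) =
     list_encode [1, encode_horizon h, encode_sformula \<Phi>, encode_sformula \<Psi>]"
| "encode_pformula (WeakUntil h \<Phi> \<Psi>) =
     list_encode [2, encode_horizon h, encode_sformula \<Phi>, encode_sformula \<Psi>]"

definition encode_instance :: "(nat, nat, nat) mdp \<Rightarrow> nat sformula \<Rightarrow> nat" where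
  "encode_instance M \<Phi> = prod_encode (encode_mdp M, encode_sformula \<Phi>)"

lemma encode_horizon_inject: "encode_horizon h = encode_horizon h' \<Longrightarrow> h = h'"
  by (cases h; cases h') auto

lemma encode_cmp_inject: "encode_cmp r = encode_cmp r' \<Longrightarrow> r = r'"
  by (cases r; cases r') auto

lemma encode_formula_inject:
  "encode_sformula \<Phi> = encode_sformula \<Phi>' \<Longrightarrow> \<Phi> = \<Phi>'"
  "encode_pformula \<phi> = encode_pformula \<phi>' \<Longrightarrow> \<phi> = \<phi>'"
proof (induction \<Phi> and \<phi> arbitrary: \<Phi>' and \<phi>' rule: sformula.induct pformula.induct)
  case (Atom p) then show ?case by (cases \<Phi>') auto
next
  case (NegAtom p) then show ?case by (cases \<Phi>') auto
next
  case (Conj \<Phi> \<Psi>) then show ?case by (cases \<Phi>') auto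
next
  case (Disj \<Phi> \<Psi>) then show ?case by (cases \<Phi>') auto
next
  case (Prob ts r c0)
  let ?e = "\<lambda>(c, \<phi>). prod_encode (int_encode c, encode_pformula \<phi>)"
  from Prob.prems obtain ts' r' c0' where \<Phi>': "\<Phi>' = Prob ts' r' c0'"
    by (cases \<Phi>') auto
  with Prob.prems have eq: "map ?e ts = map ?e ts'" "r = r'" "c0 = c0'"
    by (auto dest: encode_cmp_inject simp: int_encode_eq list_encode_eq)
  have "ts = ts'"
  proof (rule nth_equalityI)
    show len: "length ts = length ts'" using eq(1) by (rule map_eq_imp_length_eq)
    fix i assume i: "i < length ts"
    obtain c \<phi> c' \<phi>' where t: "ts ! i = (c, \<phi>)" "ts' ! i = (c', \<phi>')" by (metis surj_pair)
    have "?e (ts ! i) = ?e (ts' ! i)" using arg_cong[OF eq(1), of "\<lambda>l. l ! i"] i len by simp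
    then have "c = c'" "encode_pformula \<phi> = encode_pformula \<phi>'"
      by (auto simp: t int_encode_eq)
    moreover have "(c, \<phi>) \<in> set ts" using i t by (metis nth_mem)
    ultimately show "ts ! i = ts' ! i"
      using Prob.IH[of "(c, \<phi>)" \<phi> \<phi>'] t by auto
  qed
  with \<Phi>' eq show ?case by simp
next
  case (Next l \<Phi>) then show ?case by (cases \<phi>') auto
next
  case (Until h \<Phi> \<Psi>) then show ?case by (cases \<phi>') (auto dest: encode_horizon_inject)
next
  case (WeakUntil h \<Phi> \<Psi>) then show ?case by (cases \<phi>') (auto dest: encode_horizon_inject)
qed

lemma of_rat_rat_of_real: "x \<in> \<rat> \<Longrightarrow> of_rat (rat_of_real x) = x"
  by (auto simp: Rats_def rat_of_real_def)

lemma rat_of_real_of_rat [simp]: "rat_of_real (of_rat q) = q"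
  by (auto simp: rat_of_real_def)

lemma encode_rat_inject: "encode_rat q = encode_rat q' \<Longrightarrow> q = q'"
  by (auto simp: encode_rat_def int_encode_eq split: prod.splits intro: quotient_of_inject)

lemma encode_instance_inject:
  assumes "standard_mdp M" "standard_mdp M'" and eq: "encode_instance M \<Phi> = encode_instance M' \<Phi>'"
  shows "\<Phi> = \<Phi>'" "states M = states M'" "actions M = actions M'" "init M = init M'" "AP M = AP M'"
    "\<And>s a. s \<in> states M \<Longrightarrow> a \<in> actions M \<Longrightarrow> transition M s a = transition M' s a"
    "\<And>s. s \<in> states M \<Longrightarrow> label M s = label M' s"
proof -
  from assms obtain n m k n' m' k' where
    M: "states M = {..<n}" "actions M = {..<m}" "AP M = {..<k}" "markov_decision_process M" and
    M': "states M' = {..<n'}" "actions M' = {..<m'}" "AP M' = {..<k'}" "markov_decision_process M'"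
    by (auto simp: standard_mdp_def)
  show "\<Phi> = \<Phi>'" using eq by (auto simp: encode_instance_def intro: encode_formula_inject)
  from eq have "encode_mdp M = encode_mdp M'" by (simp add: encode_instance_def)
  then have *: "n = n'" "m = m'" "k = k'" "init M = init M'"
    "map (\<lambda>s. map (\<lambda>a. map (\<lambda>t. encode_rat (rat_of_real (pmf (transition M s a) t))) [0..<n]) [0..<m]) [0..<n] =
     map (\<lambda>s. map (\<lambda>a. map (\<lambda>t. encode_rat (rat_of_real (pmf (transition M' s a) t))) [0..<n]) [0..<m]) [0..<n]"
    "map (\<lambda>s. set_encode (label M s)) [0..<n] = map (\<lambda>s. set_encode (label M' s)) [0..<n]"
    unfolding encode_mdp_def M M' Let_def card_lessThan list_encode_eq
    by (auto simp: map_eq_conv list_encode_eq)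
  note nm = *(1-3) and init = *(4)
  have tr: "encode_rat (rat_of_real (pmf (transition M s a) t)) = encode_rat (rat_of_real (pmf (transition M' s a) t))"
    if "s < n" "a < m" "t < n" for s a t
    using *(5) that by (auto simp: map_eq_conv)
  have lb: "set_encode (label M s) = set_encode (label M' s)" if "s < n" for s
    using *(6) that by (auto simp: map_eq_conv)
  show "states M = states M'" "actions M = actions M'" "init M = init M'" "AP M = AP M'"
    using M M' nm init by auto
  show "transition M s a = transition M' s a" if sa: "s \<in> states M" "a \<in> actions M" for s a
  proof (rule pmf_eqI)
    fix t
    have s: "s < n" "a < m" using sa M by auto
    have rat: "pmf (transition M s a) t \<in> \<rat>" "pmf (transition M' s a) t \<in> \<rat>"
      and sub: "set_pmf (transition M s a) \<subseteq> {..<n}" "set_pmf (transition M' s a) \<subseteq> {..<n}"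
      using s M M' nm by (auto simp: markov_decision_process_def)
    show "pmf (transition M s a) t = pmf (transition M' s a) t"
    proof (cases "t < n")
      case True
      then show ?thesis
        using encode_rat_inject[OF tr[OF s True]] rat by (metis of_rat_rat_of_real)
    next
      case False
      then have "t \<notin> set_pmf (transition M s a)" "t \<notin> set_pmf (transition M' s a)"
        using sub by auto
      then show ?thesis by (metis pmf_eq_0_set_pmf)
    qed
  qed
  show "label M s = label M' s" if "s \<in> states M" for s
  proof -
    have s: "s < n" using that M by auto
    have "label M s \<subseteq> {..<k}" "label M' s \<subseteq> {..<k}"
      using s M M' nm by (auto simp: markov_decision_process_def)
    then have "finite (label M s)" "finite (label M' s)"
      by (meson finite_lessThan finite_subset)+
    with lb[OF s] show ?thesis by (metis set_encode_inverse)
  qed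
qed

end

theory Submission
  imports Defs
begin

text \<open>
  A coRE set is the set of inputs \<open>x\<close> on which some partial recursive \<open>f\<close> is undefined. Code a
  natural number \<open>n\<close> by \<open>2\<^sup>-\<^sup>n\<close> and ``undefined'' by the limit \<open>0\<close>. Consider trees whose nodes are
  calls of subprograms of \<open>f\<close>, carrying the coded arguments and a claimed result, such that every
  node is related to its children by the recursion equations of the called subprogram; in this
  coding they are Boolean combinations of non-strict linear inequalities. By induction on the
  evaluation, the claimed result of a terminating call is its true value, whereas the true partial
  semantics labels such a tree consistently. So \<open>f\<close> is undefined at \<open>x\<close> iff some such tree claims
  the result \<open>0\<close> for the call of \<open>f\<close> at \<open>2\<^sup>-\<^sup>x\<close>.

  A strategy of a finite MDP is such a tree: the history is the position in the tree, and a number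
  in \<open>[0, 1]\<close> attached to a node is the probability with which the strategy plays action \<open>1\<close> in a
  side branch of that node. These probabilities are visible, up to constant factors, as the
  probabilities of being in certain states after two steps (for the node itself) or three steps
  (for its children), so the constraints become a flat non-strict window formula. The input \<open>x\<close>
  occurs only in the coefficient \<open>2\<^sup>x\<close>.
\<close>

section \<open>The law of a Markov chain at a fixed time\<close>

primrec iter_pmf :: "('s \<Rightarrow> 's pmf) \<Rightarrow> nat \<Rightarrow> 's \<Rightarrow> 's pmf" where
  "iter_pmf K 0 s = return_pmf s"
| "iter_pmf K (Suc n) s = bind_pmf (iter_pmf K n s) K"

text \<open>\<open>iter_pmf\<close> peels off the last step; peeling off the first one is the form
  needed to follow a strategy forward from a history.\<close>

lemma iter_pmf_Suc': "iter_pmf K (Suc n) s = bind_pmf (K s) (iter_pmf K n)"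
proof (induction n)
  case 0
  then show ?case by (simp add: bind_return_pmf bind_return_pmf')
next
  case (Suc n)
  have "iter_pmf K (Suc (Suc n)) s = bind_pmf (bind_pmf (K s) (iter_pmf K n)) K"
    using Suc.IH by simp
  also have "\<dots> = bind_pmf (K s) (iter_pmf K (Suc n))"
    unfolding bind_assoc_pmf by (intro bind_pmf_cong) simp_all
  finally show ?case .
qed

definition cyl :: "'s list \<Rightarrow> (nat \<Rightarrow> 's) set" where
  "cyl xs = {\<omega>. \<forall>i<length xs. \<omega> i = xs ! i}"

lemma sets_path_measure_component: "{\<omega>. \<omega> n \<in> B} \<in> sets (path_measure K s)"
proof -
  have "(\<lambda>\<omega>. \<omega> n) \<in> measurable (PiM UNIV (\<lambda>_. count_space UNIV)) (count_space UNIV)"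
    by (rule measurable_component_singleton) simp
  from measurable_sets[OF this, of B] show ?thesis
    by (simp add: sets_path_measure space_PiM vimage_def)
qed

lemma sets_path_measure_cyl: "cyl xs \<in> sets (path_measure K s)"
proof -
  have "{\<omega> \<in> space (path_measure K s). \<forall>i\<in>{..<length xs}. \<omega> i \<in> {xs ! i}} \<in> sets (path_measure K s)"
    by (intro sets.sets_Collect_finite_All)
       (simp_all only: space_path_measure UNIV_I simp_thms sets_path_measure_component finite_lessThan)
  then show ?thesis by (simp add: cyl_def Ball_def)
qed
 
lemma emeasure_cyl_snoc:
  "emeasure (path_measure K s) (cyl (xs @ [y, z])) =
     emeasure (path_measure K s) (cyl (xs @ [y])) * ennreal (pmf (K y) z)"
proof -
  let ?x = "\<lambda>i. (xs @ [y, z]) ! i"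
  have 1: "cyl (xs @ [y, z]) = {\<omega>. \<forall>i\<le>Suc (length xs). \<omega> i = ?x i}"
    by (simp add: cyl_def less_Suc_eq_le)
  have 2: "cyl (xs @ [y]) = {\<omega>. \<forall>i\<le>length xs. \<omega> i = ?x i}"
    by (auto simp: cyl_def less_Suc_eq_le nth_append)
  show ?thesis
    unfolding 1 2 emeasure_path_measure_cylinder by (simp add: nth_append)
qed

text \<open>The Markov property at time \<open>n\<close>. The event splits by its first
  \<open>n\<close> states into cylinders, countably many because the state type is countable, and
  each of them picks up the same factor.\<close>

lemma emeasure_path_measure_pair:
  fixes K :: "'s :: countable \<Rightarrow> 's pmf"
  shows "emeasure (path_measure K s) {\<omega>. \<omega> n = y \<and> \<omega> (Suc n) = z} =
    emeasure (path_measure K s) {\<omega>. \<omega> n = y} * ennreal (pmf (K y) z)"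
proof -
  let ?M = "path_measure K s" and ?L = "{xs :: 's list. length xs = n}"
  have split: "emeasure ?M (\<Union>xs\<in>?L. cyl (xs @ ys)) = (\<integral>\<^sup>+xs. emeasure ?M (cyl (xs @ ys)) \<partial>count_space ?L)" for ys
  proof (rule emeasure_UN_countable)
    show "disjoint_family_on (\<lambda>xs. cyl (xs @ ys)) ?L"
    proof (unfold disjoint_family_on_def, intro ballI impI)
      fix xs xs' assume *: "xs \<in> ?L" "xs' \<in> ?L" "xs \<noteq> xs'"
      then obtain i where "i < n" "xs ! i \<noteq> xs' ! i" by (auto simp: list_eq_iff_nth_eq)
      with * show "cyl (xs @ ys) \<inter> cyl (xs' @ ys) = {}"
        by (fastforce simp: cyl_def nth_append dest!: spec[of _ i])
    qed
  qed (auto intro: sets_path_measure_cyl)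
  have prefix: "\<exists>xs. length xs = n \<and> (\<forall>i<n. \<omega> i = xs ! i)" for \<omega> :: "nat \<Rightarrow> 's"
    by (rule exI[of _ "map \<omega> [0..<n]"]) simp
  have 1: "{\<omega>. \<omega> n = y} = (\<Union>xs\<in>?L. cyl (xs @ [y]))"
    by (auto simp: cyl_def nth_append less_Suc_eq prefix)
  have 2: "{\<omega>. \<omega> n = y \<and> \<omega> (Suc n) = z} = (\<Union>xs\<in>?L. cyl (xs @ [y, z]))"
    by (auto simp: cyl_def nth_append less_Suc_eq prefix)
  show ?thesis
    unfolding 1 2 split emeasure_cyl_snoc by (rule nn_integral_multc) simp
qed

lemma emeasure_path_measure_component:
  fixes K :: "'s :: countable \<Rightarrow> 's pmf"
  shows "emeasure (path_measure K s) {\<omega>. \<omega> n = y} = ennreal (pmf (iter_pmf K n s) y)"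
proof (induction n arbitrary: y)
  case 0
  have "{\<omega> :: nat \<Rightarrow> 's. \<omega> 0 = y} = {\<omega>. \<forall>i\<le>0. \<omega> i = y}" by auto
  then show ?case
    using emeasure_path_measure_cylinder[of K s 0 "\<lambda>_. y"] by (auto simp: indicator_def)
next
  case (Suc n)
  let ?M = "path_measure K s"
  have "{\<omega>. \<omega> (Suc n) = y} = (\<Union>x. {\<omega>. \<omega> n = x \<and> \<omega> (Suc n) = y})" by auto
  also have "emeasure ?M \<dots> = (\<integral>\<^sup>+x. emeasure ?M {\<omega>. \<omega> n = x \<and> \<omega> (Suc n) = y} \<partial>count_space UNIV)"
  proof (rule emeasure_UN_countable)
    fix x
    have "{\<omega>. \<omega> n = x \<and> \<omega> (Suc n) = y} = {\<omega>. \<omega> n \<in> {x}} \<inter> {\<omega>. \<omega> (Suc n) \<in> {y}}" by auto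
    then show "{\<omega>. \<omega> n = x \<and> \<omega> (Suc n) = y} \<in> sets ?M"
      by (simp only: sets.Int sets_path_measure_component)
  qed (auto simp: disjoint_family_on_def)
  also have "\<dots> = (\<integral>\<^sup>+x. ennreal (pmf (K x) y) \<partial>measure_pmf (iter_pmf K n s))"
    by (simp add: emeasure_path_measure_pair Suc.IH nn_integral_measure_pmf)
  finally show ?case by (simp add: ennreal_pmf_bind)
qed

lemma measure_path_measure_component:
  fixes K :: "'s :: countable \<Rightarrow> 's pmf"
  shows "measure (path_measure K s) {\<omega>. \<omega> n \<in> B} = measure (iter_pmf K n s) B"
proof -
  let ?M = "path_measure K s"
  have "{\<omega>. \<omega> n \<in> B} = (\<Union>y\<in>B. {\<omega>. \<omega> n = y})" by auto
  also have "emeasure ?M \<dots> = (\<integral>\<^sup>+y. emeasure ?M {\<omega>. \<omega> n = y} \<partial>count_space B)"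
    using sets_path_measure_component[of n "{y}" for y]
    by (intro emeasure_UN_countable) (auto simp: disjoint_family_on_def)
  also have "\<dots> = emeasure (iter_pmf K n s) B"
    unfolding emeasure_path_measure_component by (rule nn_integral_pmf)
  finally show ?thesis by (simp add: measure_def)
qed

section \<open>Chains and MDPs that coincide on a closed set of states\<close>

text \<open>The code of an instance fixes an MDP only on its own states and actions, so MDPs with
  equal codes may differ elsewhere. \<open>S\<close> is a closed set on which such a difference is
  invisible.\<close>

definition mc_agree :: "('s, 'p) mc \<Rightarrow> ('s, 'p) mc \<Rightarrow> 's set \<Rightarrow> bool" where
  "mc_agree C C' S \<longleftrightarrow>
     (\<forall>s\<in>S. mc_trans C s = mc_trans C' s \<and> set_pmf (mc_trans C s) \<subseteq> S \<and> mc_label C s = mc_label C' s)"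

lemma iter_pmf_agree:
  assumes "mc_agree C C' S" "s \<in> S"
  shows "iter_pmf (mc_trans C) n s = iter_pmf (mc_trans C') n s"
    and "set_pmf (iter_pmf (mc_trans C) n s) \<subseteq> S"
proof -
  have "iter_pmf (mc_trans C) n s = iter_pmf (mc_trans C') n s \<and> set_pmf (iter_pmf (mc_trans C) n s) \<subseteq> S"
  proof (induction n)
    case (Suc n)
    then have "bind_pmf (iter_pmf (mc_trans C) n s) (mc_trans C) = bind_pmf (iter_pmf (mc_trans C') n s) (mc_trans C')"
      using assms(1) by (intro bind_pmf_cong) (auto simp: mc_agree_def)
    with Suc assms(1) show ?case by (fastforce simp: mc_agree_def)
  qed (use assms(2) in simp)
  then show "iter_pmf (mc_trans C) n s = iter_pmf (mc_trans C') n s"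
    and "set_pmf (iter_pmf (mc_trans C) n s) \<subseteq> S" by auto
qed

text \<open>The law at time \<open>n\<close> started in \<open>S\<close> is concentrated on
  \<open>S\<close>, where labels coincide. \<open>Next\<close> of an atom is the only kind of path
  formula that the reduction produces.\<close>

lemma measure_Next_Atom_agree:
  fixes C C' :: "('s :: countable, 'p) mc"
  assumes "mc_agree C C' S" "s \<in> S"
  shows "measure (path_measure (mc_trans C) s) {\<omega>. psat C \<omega> (Next n (Atom p))} =
    measure (path_measure (mc_trans C') s) {\<omega>. psat C' \<omega> (Next n (Atom p))}"
proof -
  have *: "measure (path_measure (mc_trans D) s) {\<omega>. psat D \<omega> (Next n (Atom p))} =
      measure (iter_pmf (mc_trans D) n s) {s. p \<in> mc_label D s}" for D :: "('s, 'p) mc"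
    using measure_path_measure_component[of "mc_trans D" s n "{s. p \<in> mc_label D s}"] by simp
  have "measure (iter_pmf (mc_trans C) n s) {s. p \<in> mc_label C s} =
      measure (iter_pmf (mc_trans C) n s) {s. p \<in> mc_label C' s}"
    using iter_pmf_agree(2)[OF assms, of n] assms(1)
    by (intro measure_pmf.finite_measure_eq_AE) (auto simp: AE_measure_pmf_iff mc_agree_def)
  then show ?thesis by (simp only: * iter_pmf_agree(1)[OF assms])
qed

definition mdp_agree :: "('s, 'a, 'p) mdp \<Rightarrow> ('s, 'a, 'p) mdp \<Rightarrow> bool" where
  "mdp_agree M M' \<longleftrightarrow>
     states M = states M' \<and> actions M = actions M' \<and> init M = init M' \<and>
     (\<forall>s\<in>states M. label M s = label M' s \<and> (\<forall>a\<in>actions M. transition M s a = transition M' s a))"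

lemma mdp_agree_finite_paths:
  assumes "mdp_agree M M'" "\<rho> \<in> finite_paths M"
  shows "\<rho> \<in> finite_paths M'"
  using assms(2)
proof (induction rule: finite_paths.induct)
  case (single s)
  then show ?case using assms(1) by (auto simp: mdp_agree_def intro: finite_paths.single)
next
  case (extend \<rho> a s)
  then show ?case
    using assms(1) last_state_in_states[OF extend.hyps(1)]
    by (auto simp: mdp_agree_def intro!: finite_paths.extend)
qed

lemma mdp_agree_is_strategy: "mdp_agree M M' \<Longrightarrow> is_strategy M' \<sigma> \<Longrightarrow> is_strategy M \<sigma>"
  using mdp_agree_finite_paths[of M M'] unfolding is_strategy_def mdp_agree_def by metis

text \<open>Finite paths end in states of the MDP, and after them the strategy plays only actions of
  the MDP, so only values covered by \<open>mdp_agree\<close> enter.\<close>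

lemma mc_agree_induced_mc:
  assumes agree: "mdp_agree M M'" and M: "markov_decision_process M" and \<sigma>: "is_strategy M \<sigma>"
  shows "mc_agree (induced_mc M \<sigma>) (induced_mc M' \<sigma>) (finite_paths M)"
  unfolding mc_agree_def
proof (intro ballI conjI)
  fix \<rho> assume \<rho>: "\<rho> \<in> finite_paths M"
  have s: "last_state \<rho> \<in> states M" by (rule last_state_in_states[OF \<rho>])
  have "transition M (last_state \<rho>) a = transition M' (last_state \<rho>) a" if "a \<in> set_pmf (\<sigma> \<rho>)" for a
    using agree s \<sigma> \<rho> that unfolding mdp_agree_def is_strategy_def by blast
  then show "mc_trans (induced_mc M \<sigma>) \<rho> = mc_trans (induced_mc M' \<sigma>) \<rho>"
    by (auto simp: induced_mc_def intro!: bind_pmf_cong)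
  show "set_pmf (mc_trans (induced_mc M \<sigma>) \<rho>) \<subseteq> finite_paths M"
    using markov_chain_induced_mc[OF M \<sigma>] \<rho> by (simp add: markov_chain_def induced_mc_def)
  show "mc_label (induced_mc M \<sigma>) \<rho> = mc_label (induced_mc M' \<sigma>) \<rho>"
    using agree s by (simp add: induced_mc_def mdp_agree_def)
qed

section \<open>Trees of linear constraints as strategies\<close>

text \<open>\<open>Own i\<close> is slot \<open>i\<close> of a node, and \<open>Chd t i\<close> is
  slot \<open>i\<close> of its unique child of type \<open>t\<close>.\<close>

datatype var = Own nat | Chd nat nat

text \<open>There is no negation, since negating a non-strict inequality would give a strict
  one.\<close>

datatype con = Lin "(int \<times> var) list" int | And con con | Or con con

fun vval :: "(nat \<Rightarrow> real) \<Rightarrow> (nat \<Rightarrow> nat \<Rightarrow> real) \<Rightarrow> var \<Rightarrow> real" where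
  "vval v w (Own i) = v i"
| "vval v w (Chd t i) = w t i"

fun csat :: "(nat \<Rightarrow> real) \<Rightarrow> (nat \<Rightarrow> nat \<Rightarrow> real) \<Rightarrow> con \<Rightarrow> bool" where
  "csat v w (Lin ts c) \<longleftrightarrow> (\<Sum>(a, u)\<leftarrow>ts. real_of_int a * vval v w u) \<ge> real_of_int c"
| "csat v w (And c d) \<longleftrightarrow> csat v w c \<and> csat v w d"
| "csat v w (Or c d) \<longleftrightarrow> csat v w c \<or> csat v w d"

fun var_ok :: "nat \<Rightarrow> nat \<Rightarrow> var \<Rightarrow> bool" where
  "var_ok N K (Own i) \<longleftrightarrow> i < K"
| "var_ok N K (Chd t i) \<longleftrightarrow> t < N \<and> i < K"

fun con_ok :: "nat \<Rightarrow> nat \<Rightarrow> con \<Rightarrow> bool" where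
  "con_ok N K (Lin ts c) \<longleftrightarrow> ts \<noteq> [] \<and> (\<forall>(a, u)\<in>set ts. var_ok N K u)"
| "con_ok N K (And c d) \<longleftrightarrow> con_ok N K c \<and> con_ok N K d"
| "con_ok N K (Or c d) \<longleftrightarrow> con_ok N K c \<and> con_ok N K d"

text \<open>Tree positions are lists of node types with the innermost type first; the root has type
  \<open>r\<close>.\<close>

definition tree_model :: "nat \<Rightarrow> nat \<Rightarrow> (nat \<Rightarrow> con) \<Rightarrow> (nat list \<Rightarrow> nat \<Rightarrow> real) \<Rightarrow> bool" where
  "tree_model N r C V \<longleftrightarrow>
     (\<forall>\<pi>. set \<pi> \<subseteq> {..<N} \<longrightarrow>
        (\<forall>i. 0 \<le> V \<pi> i \<and> V \<pi> i \<le> 1) \<and> csat (V \<pi>) (\<lambda>t. V (t # \<pi>)) (C (hd (\<pi> @ [r]))))"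

lemma csat_cong:
  assumes "con_ok N K c" "\<And>u. var_ok N K u \<Longrightarrow> vval v w u = vval v' w' u"
  shows "csat v w c \<longleftrightarrow> csat v' w' c"
  using assms(1)
proof (induction c)
  case (Lin ts c)
  have "map (\<lambda>(a, u). real_of_int a * vval v w u) ts = map (\<lambda>(a, u). real_of_int a * vval v' w' u) ts"
    using Lin assms(2) by (intro map_cong) auto
  then show ?case by (simp only: csat.simps)
qed auto

section \<open>The MDP and the formula that encode a constraint tree\<close>

locale tree_mdp =
  fixes N K r :: nat
  assumes root: "r < N"
begin

text \<open>States are laid out in blocks: the \<open>N\<close> node types, a gadget for each node
  type and slot, a \<open>yes\<close> state for each gadget, then \<open>dead\<close> and
  \<open>bad\<close>. A gadget is the side branch in which a slot value is played.\<close>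

definition gadget :: "nat \<Rightarrow> nat \<Rightarrow> nat" where
  "gadget t i = N + (t * K + i)"

definition yes :: "nat \<Rightarrow> nat \<Rightarrow> nat" where
  "yes t i = gadget t i + N * K"

definition dead :: nat where
  "dead = N + N * K + N * K"

definition bad :: nat where
  "bad = Suc dead"

text \<open>A node leads to a node of any type or to a gadget of its own type, which makes
  \<open>N + K\<close> options for the uniform choice in \<open>trans\<close>.\<close>

definition succs :: "nat \<Rightarrow> nat set" where
  "succs t = {..<N} \<union> {N + t * K..<N + t * K + K}"

text \<open>The state \<open>bad\<close> is forbidden by the formula, which forces action \<open>0\<close> in all node states;
  otherwise the strategy could randomise there and let the subtrees depend on the outcome.\<close>

definition trans :: "nat \<Rightarrow> nat \<Rightarrow> nat pmf" where
  "trans s a =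
     (if s < N then if a = 0 then pmf_of_set (succs s) else return_pmf bad
      else if s < N + N * K \<and> a = 1 then return_pmf (s + N * K)
      else return_pmf dead)"

text \<open>Each state is its own atomic proposition, so \<open>Next n (Atom y)\<close> is the event
  of being in \<open>y\<close> at time \<open>n\<close>.\<close>

definition M :: "(nat, nat, nat) mdp" where
  "M = \<lparr>states = {..<Suc bad}, actions = {..<2}, init = r, transition = trans,
        AP = {..<Suc bad}, label = (\<lambda>s. {s})\<rparr>"

text \<open>An own slot becomes visible after one uniform choice, a slot of a child after two. The
  factors \<open>N + K\<close> and its square cancel these choices and keep the coefficients
  integral.\<close>

fun lin_term :: "nat \<Rightarrow> int \<times> var \<Rightarrow> int \<times> nat pformula" where
  "lin_term t (a, Own i) = (a * int (N + K), Next 2 (Atom (yes t i)))"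
| "lin_term t (a, Chd t' i) = (a * int ((N + K)\<^sup>2), Next 3 (Atom (yes t' i)))"

fun con_formula :: "nat \<Rightarrow> con \<Rightarrow> nat sformula" where
  "con_formula t (Lin ts c) = Prob (map (lin_term t) ts) GE c"
| "con_formula t (And c d) = Conj (con_formula t c) (con_formula t d)"
| "con_formula t (Or c d) = Disj (con_formula t c) (con_formula t d)"

definition tree_formula :: "(nat \<Rightarrow> con) \<Rightarrow> nat sformula" where
  "tree_formula C =
     foldr (\<lambda>t. Conj (Disj (NegAtom t) (con_formula t (C t)))) [0..<N] (NegAtom bad)"

lemma finite_succs [simp]: "finite (succs t)" "succs t \<noteq> {}"
  using root by (auto simp: succs_def)

lemma card_succs [simp]: "card (succs t) = N + K"
  unfolding succs_def by (subst card_Un_disjoint) auto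

lemma gadget_less: "t < N \<Longrightarrow> i < K \<Longrightarrow> gadget t i < N + N * K"
proof -
  assume "t < N" "i < K"
  then have "t * K + i < Suc t * K" by simp
  also have "\<dots> \<le> N * K" using \<open>t < N\<close> by (intro mult_le_mono1) simp
  finally show ?thesis by (simp add: gadget_def)
qed

lemma succs_less: "t < N \<Longrightarrow> s \<in> succs t \<Longrightarrow> s < N + N * K"
proof -
  assume t: "t < N" and s: "s \<in> succs t"
  have "t * K + K = Suc t * K" by simp
  also have "\<dots> \<le> N * K" using t by (intro mult_le_mono1) simp
  finally show ?thesis using s t by (auto simp: succs_def)
qed

lemma node_in_succs: "s < N \<Longrightarrow> s \<in> succs t"
  by (simp add: succs_def)

lemma gadget_in_succs_iff: "i < K \<Longrightarrow> gadget t' i \<in> succs t \<longleftrightarrow> t' = t"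
proof
  assume i: "i < K" and "gadget t' i \<in> succs t"
  then have *: "t * K \<le> t' * K + i" "t' * K + i < t * K + K"
    by (auto simp: gadget_def succs_def)
  have "(t' * K + i) div K = t'" using i by simp
  moreover have "(t' * K + i) div K = t"
    using * by (intro div_nat_eqI) (auto simp: mult.commute)
  ultimately show "t' = t" by simp
qed (auto simp: gadget_def succs_def)

lemma M_simps [simp]:
  "states M = {..<Suc bad}" "actions M = {..<2}" "init M = r" "transition M = trans"
  "AP M = {..<Suc bad}" "label M s = {s}"
  by (simp_all add: M_def)

lemma standard_mdp_M: "standard_mdp M"
proof -
  have "set_pmf (trans s a) \<subseteq> {..<Suc bad}" for s a
    using succs_less[of s] by (auto simp: trans_def bad_def dead_def) force
  moreover have "pmf (trans s a) t \<in> \<rat>" for s a t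
    by (auto simp: trans_def pmf_of_set indicator_def)
  ultimately show ?thesis
    using root by (auto simp: standard_mdp_def markov_decision_process_def bad_def dead_def)
qed

lemma yes_less: "t < N \<Longrightarrow> i < K \<Longrightarrow> yes t i < Suc bad"
  using gadget_less[of t i] by (simp add: yes_def bad_def dead_def)

lemma lin_term_cases:
  obtains l y where "snd (lin_term t x) = Next l (Atom y)"
    and "t < N \<Longrightarrow> var_ok N K (snd x) \<Longrightarrow> y < Suc bad"
  by (cases "(t, x)" rule: lin_term.cases) (auto simp: yes_less)

lemma con_formula_props:
  assumes "con_ok N K c" "t < N"
  shows "wf_sformula (con_formula t c) \<and> window (con_formula t c) \<and>
    flat_formula (con_formula t c) \<and> non_strict (con_formula t c) \<and>
    atoms (con_formula t c) \<subseteq> AP M"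
  using assms(1)
proof (induction c)
  case (Lin ts c)
  have 1: "wf_pformula \<phi> \<and> path_window \<phi> \<and> path_prob_free \<phi> \<and> path_non_strict \<phi> \<and>
      path_atoms \<phi> \<subseteq> AP M" if mem: "(a, \<phi>) \<in> lin_term t ` set ts" for a \<phi>
  proof -
    obtain x where x: "x \<in> set ts" "lin_term t x = (a, \<phi>)" using mem by fastforce
    obtain l y where ly: "snd (lin_term t x) = Next l (Atom y)"
      "t < N \<Longrightarrow> var_ok N K (snd x) \<Longrightarrow> y < Suc bad"
      using lin_term_cases[of t x] by blast
    have "var_ok N K (snd x)" using Lin x(1) by auto
    then have "y < Suc bad" using ly(2) assms(2) by blast
    moreover have "\<phi> = Next l (Atom y)" using ly(1) x(2) by simp
    ultimately show ?thesis by simp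
  qed
  have "\<forall>(a, \<phi>)\<in>lin_term t ` set ts. P \<phi>"
    if "\<And>\<phi>. wf_pformula \<phi> \<and> path_window \<phi> \<and> path_prob_free \<phi> \<and> path_non_strict \<phi> \<and>
      path_atoms \<phi> \<subseteq> AP M \<Longrightarrow> P \<phi>" for P
    using that 1 by blast
  then have "\<forall>(a, \<phi>)\<in>lin_term t ` set ts. wf_pformula \<phi>" "\<forall>(a, \<phi>)\<in>lin_term t ` set ts. path_window \<phi>"
    "\<forall>(a, \<phi>)\<in>lin_term t ` set ts. path_prob_free \<phi>" "\<forall>(a, \<phi>)\<in>lin_term t ` set ts. path_non_strict \<phi>"
    by blast+
  moreover have "atoms (con_formula t (Lin ts c)) \<subseteq> AP M"
  proof
    fix p assume "p \<in> atoms (con_formula t (Lin ts c))"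
    then obtain x where "x \<in> set ts" "p \<in> path_atoms (snd (lin_term t x))"
      by (auto elim!: snds.cases)
    with 1[of "fst (lin_term t x)" "snd (lin_term t x)"] show "p \<in> AP M" by auto
  qed
  ultimately show ?case using Lin by simp
qed auto

lemma tree_formula_props:
  assumes "\<And>t. t < N \<Longrightarrow> con_ok N K (C t)"
  shows "wf_sformula (tree_formula C)" "window (tree_formula C)"
    "flat_formula (tree_formula C)" "non_strict (tree_formula C)" "atoms (tree_formula C) \<subseteq> AP M"
proof -
  define ts where "ts = [0..<N]"
  have "\<forall>t\<in>set ts. t < N" by (simp add: ts_def)
  then have "wf_sformula \<Phi> \<and> window \<Phi> \<and> flat_formula \<Phi> \<and> non_strict \<Phi> \<and> atoms \<Phi> \<subseteq> {..<Suc bad}"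
    if "\<Phi> = foldr (\<lambda>t. Conj (Disj (NegAtom t) (con_formula t (C t)))) ts (NegAtom bad)" for \<Phi>
    using that
  proof (induction ts arbitrary: \<Phi>)
    case (Cons t ts)
    have "t < Suc bad" using Cons.prems(1) by (simp add: bad_def dead_def)
    then show ?case
      using Cons.IH[OF _ refl] Cons.prems con_formula_props[OF assms, of t t] by simp
  qed simp
  then show "wf_sformula (tree_formula C)" "window (tree_formula C)"
    "flat_formula (tree_formula C)" "non_strict (tree_formula C)" "atoms (tree_formula C) \<subseteq> AP M"
    by (auto simp: tree_formula_def ts_def)
qed

section \<open>Laws after one, two and three steps\<close>

text \<open>States of the induced chain are whole histories, whereas the formula only sees where a
  history ends.\<close>

definition law :: "(nat, nat) strategy \<Rightarrow> nat \<Rightarrow> (nat, nat) fpath \<Rightarrow> nat pmf" where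
  "law \<sigma> n \<rho> = map_pmf last_state (iter_pmf (mc_trans (induced_mc M \<sigma>)) n \<rho>)"

lemma measure_Next_Atom:
  "measure (path_measure (mc_trans (induced_mc M \<sigma>)) \<rho>) {\<omega>. psat (induced_mc M \<sigma>) \<omega> (Next n (Atom y))} =
     pmf (law \<sigma> n \<rho>) y"
proof -
  have "{\<omega>. psat (induced_mc M \<sigma>) \<omega> (Next n (Atom y))} = {\<omega>. \<omega> n \<in> last_state -` {y}}"
    by (auto simp: induced_mc_def)
  then show ?thesis
    by (simp only: measure_path_measure_component law_def pmf_map)
qed

lemma law_0: "law \<sigma> 0 \<rho> = return_pmf (last_state \<rho>)"
  by (simp add: law_def)

lemma law_Suc:
  "law \<sigma> (Suc n) \<rho> =
     bind_pmf (\<sigma> \<rho>) (\<lambda>a. bind_pmf (trans (last_state \<rho>) a) (\<lambda>s. law \<sigma> n (extend_path \<rho> a s)))"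
proof -
  have "law \<sigma> (Suc n) \<rho> = map_pmf last_state
      (bind_pmf (mc_trans (induced_mc M \<sigma>) \<rho>) (iter_pmf (mc_trans (induced_mc M \<sigma>)) n))"
    by (simp only: law_def iter_pmf_Suc')
  also have "\<dots> = bind_pmf (mc_trans (induced_mc M \<sigma>) \<rho>) (law \<sigma> n)"
    by (simp add: map_bind_pmf law_def[abs_def])
  finally show ?thesis
    by (simp add: induced_mc_def bind_assoc_pmf bind_map_pmf)
qed

lemma law_Suc_node:
  assumes "last_state \<rho> < N" "\<sigma> \<rho> = return_pmf 0"
  shows "pmf (law \<sigma> (Suc n) \<rho>) y =
    (\<Sum>s\<in>succs (last_state \<rho>). pmf (law \<sigma> n (extend_path \<rho> 0 s)) y) / real (N + K)"
  using assms
  by (simp add: law_Suc bind_return_pmf trans_def pmf_bind_pmf_of_set del: of_nat_add)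

text \<open>A \<open>yes\<close> state is entered only from its own gadget and only by action
  \<open>1\<close>; from a node it takes at least two steps.\<close>

lemma law_1:
  assumes "last_state \<rho> < N + N * K" "last_state \<rho> < N \<Longrightarrow> \<sigma> \<rho> = return_pmf 0"
    and "t < N" "i < K"
  shows "pmf (law \<sigma> 1 \<rho>) (yes t i) = (if last_state \<rho> = gadget t i then pmf (\<sigma> \<rho>) 1 else 0)"
proof (cases "last_state \<rho> < N")
  case True
  have "N + N * K \<le> yes t i" by (simp add: yes_def gadget_def)
  then have "s \<in> succs (last_state \<rho>) \<Longrightarrow> s \<noteq> yes t i" for s
    using succs_less[OF True, of s] by auto
  then have "pmf (law \<sigma> 1 \<rho>) (yes t i) = 0"
    unfolding One_nat_def law_Suc_node[of _ \<sigma>, OF True assms(2)[OF True]] law_0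
    by (subst sum.neutral) (auto simp: indicator_def)
  moreover have "last_state \<rho> \<noteq> gadget t i" using True by (auto simp: gadget_def)
  ultimately show ?thesis by simp
next
  case False
  have "dead \<noteq> yes t i" using gadget_less[OF assms(3,4)] by (simp add: dead_def yes_def)
  then have "pmf (law \<sigma> 1 \<rho>) (yes t i) =
      (\<integral>a. (if last_state \<rho> = gadget t i then indicator {1} a else 0) \<partial>measure_pmf (\<sigma> \<rho>))"
    using False assms(1)
    unfolding One_nat_def law_Suc law_0 pmf_bind[of "\<sigma> \<rho>"]
    by (intro Bochner_Integration.integral_cong)
       (auto simp: trans_def bind_return_pmf yes_def indicator_def)
  then show ?thesis by (auto simp: measure_pmf_single)
qed

text \<open>The only route of length two to \<open>yes t i\<close> runs through
  \<open>gadget t i\<close>, which is a successor of nodes of type \<open>t\<close> alone.\<close>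

lemma law_2_node:
  assumes "last_state \<rho> < N" "\<sigma> \<rho> = return_pmf 0"
    and "\<And>s. s < N \<Longrightarrow> \<sigma> (extend_path \<rho> 0 s) = return_pmf 0"
    and "t < N" "i < K"
  shows "pmf (law \<sigma> 2 \<rho>) (yes t i) =
    (if last_state \<rho> = t then pmf (\<sigma> (extend_path \<rho> 0 (gadget t i))) 1 else 0) / real (N + K)"
proof -
  let ?v = "pmf (\<sigma> (extend_path \<rho> 0 (gadget t i))) 1"
  have "(\<Sum>s\<in>succs (last_state \<rho>). pmf (law \<sigma> 1 (extend_path \<rho> 0 s)) (yes t i)) =
      (\<Sum>s\<in>succs (last_state \<rho>). if s = gadget t i then ?v else 0)"
    using succs_less[OF assms(1)] assms(3-5) by (intro sum.cong refl) (subst law_1, auto)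
  also have "\<dots> = (if last_state \<rho> = t then ?v else 0)"
    using gadget_in_succs_iff[OF assms(5)] by (auto simp: sum.delta')
  finally show ?thesis
    unfolding numeral_2_eq_2 law_Suc_node[of _ \<sigma>, OF assms(1,2)] by simp
qed

text \<open>Two steps after a gadget the run is in \<open>dead\<close>, so gadgets contribute
  nothing to the three-step law of a node.\<close>

lemma law_2_gadget:
  assumes "N \<le> last_state \<rho>" "last_state \<rho> < N + N * K" "t < N" "i < K"
  shows "pmf (law \<sigma> 2 \<rho>) (yes t i) = 0"
proof -
  have "set_pmf (law \<sigma> 2 \<rho>) \<subseteq> {dead}"
    using assms(1,2) by (auto simp: numeral_2_eq_2 law_Suc law_0 trans_def dead_def split: if_splits)
  moreover have "dead \<noteq> yes t i" using gadget_less[OF assms(3,4)] by (simp add: dead_def yes_def)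
  ultimately show ?thesis by (auto simp: pmf_eq_0_set_pmf)
qed

text \<open>Only the child of type \<open>t\<close> can reach \<open>yes t i\<close> in two further
  steps. Since a node has children of all types, its own type does not matter here.\<close>

lemma law_3_node:
  assumes "last_state \<rho> < N" "\<sigma> \<rho> = return_pmf 0"
    and "\<And>s. s < N \<Longrightarrow> \<sigma> (extend_path \<rho> 0 s) = return_pmf 0"
    and "\<And>s s'. s < N \<Longrightarrow> s' < N \<Longrightarrow> \<sigma> (extend_path (extend_path \<rho> 0 s) 0 s') = return_pmf 0"
    and "t < N" "i < K"
  shows "pmf (law \<sigma> 3 \<rho>) (yes t i) =
    pmf (\<sigma> (extend_path (extend_path \<rho> 0 t) 0 (gadget t i))) 1 / (real (N + K))\<^sup>2"
proof -
  let ?v = "pmf (\<sigma> (extend_path (extend_path \<rho> 0 t) 0 (gadget t i))) 1 / real (N + K)"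
  have "(\<Sum>s\<in>succs (last_state \<rho>). pmf (law \<sigma> 2 (extend_path \<rho> 0 s)) (yes t i)) =
      (\<Sum>s\<in>succs (last_state \<rho>). if s = t then ?v else 0)"
  proof (intro sum.cong refl)
    fix s assume s: "s \<in> succs (last_state \<rho>)"
    show "pmf (law \<sigma> 2 (extend_path \<rho> 0 s)) (yes t i) = (if s = t then ?v else 0)"
    proof (cases "s < N")
      case True
      then show ?thesis using assms by (subst law_2_node) auto
    next
      case False
      then show ?thesis
        using assms(5,6) succs_less[OF assms(1) s] by (subst law_2_gadget) auto
    qed
  qed
  also have "\<dots> = ?v" using assms(5) by (auto simp: sum.delta' succs_def)
  finally show ?thesis
    unfolding numeral_3_eq_3 law_Suc_node[of _ \<sigma>, OF assms(1,2)]
    by (simp add: numeral_2_eq_2 power2_eq_square)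
qed

definition slot :: "(nat, nat) strategy \<Rightarrow> (nat, nat) fpath \<Rightarrow> nat \<Rightarrow> real" where
  "slot \<sigma> \<rho> i = pmf (\<sigma> (extend_path \<rho> 0 (gadget (last_state \<rho>) i))) 1"

text \<open>The relevant node states are the node, its children and its grandchildren. With action
  \<open>0\<close> certain there, the two- and three-step laws are slot values up to the factors
  that \<open>lin_term\<close> cancels.\<close>

lemma sat_con_formula:
  assumes "last_state \<rho> < N" "\<sigma> \<rho> = return_pmf 0"
    and "\<And>s. s < N \<Longrightarrow> \<sigma> (extend_path \<rho> 0 s) = return_pmf 0"
    and "\<And>s s'. s < N \<Longrightarrow> s' < N \<Longrightarrow> \<sigma> (extend_path (extend_path \<rho> 0 s) 0 s') = return_pmf 0"
    and "con_ok N K c"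
  shows "sat (induced_mc M \<sigma>) \<rho> (con_formula (last_state \<rho>) c) \<longleftrightarrow>
    csat (slot \<sigma> \<rho>) (\<lambda>t. slot \<sigma> (extend_path \<rho> 0 t)) c"
  using assms(5)
proof (induction c)
  case (Lin ts c)
  let ?mu = "\<lambda>\<phi>. measure (path_measure (mc_trans (induced_mc M \<sigma>)) \<rho>) {\<omega>. psat (induced_mc M \<sigma>) \<omega> \<phi>}"
  let ?v = "vval (slot \<sigma> \<rho>) (\<lambda>t. slot \<sigma> (extend_path \<rho> 0 t))"
  have D: "real (N + K) \<noteq> 0" using root by simp
  have "(case lin_term (last_state \<rho>) x of (a, \<phi>) \<Rightarrow> real_of_int a * ?mu \<phi>) =
      (case x of (a, u) \<Rightarrow> real_of_int a * ?v u)" if "x \<in> set ts" for x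
  proof -
    obtain a u where x: "x = (a, u)" by (cases x)
    have "var_ok N K u" using Lin that x by auto
    then show ?thesis
      using D by (cases u) (simp_all add: x measure_Next_Atom law_2_node law_3_node slot_def assms(1-4)
          del: of_nat_add psat.simps)
  qed
  then have "map (\<lambda>x. case lin_term (last_state \<rho>) x of (a, \<phi>) \<Rightarrow> real_of_int a * ?mu \<phi>) ts =
      map (\<lambda>(a, u). real_of_int a * ?v u) ts"
    by (intro map_cong) auto
  then show ?case by (simp only: con_formula.simps sat.simps compare.simps csat.simps map_map comp_def)
qed auto

lemma sat_tree_formula:
  "sat (induced_mc M \<sigma>) \<rho> (tree_formula C) \<longleftrightarrow>
     last_state \<rho> \<noteq> bad \<and>
     (last_state \<rho> < N \<longrightarrow> sat (induced_mc M \<sigma>) \<rho> (con_formula (last_state \<rho>) (C (last_state \<rho>))))"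
proof -
  have label: "mc_label (induced_mc M \<sigma>) \<rho> = {last_state \<rho>}" by (simp add: induced_mc_def)
  have "sat (induced_mc M \<sigma>) \<rho>
      (foldr (\<lambda>t. Conj (Disj (NegAtom t) (con_formula t (C t)))) ts (NegAtom bad)) \<longleftrightarrow>
     last_state \<rho> \<noteq> bad \<and>
     (last_state \<rho> \<in> set ts \<longrightarrow> sat (induced_mc M \<sigma>) \<rho> (con_formula (last_state \<rho>) (C (last_state \<rho>))))" for ts
    by (induction ts) (auto simp: label)
  then show ?thesis by (simp add: tree_formula_def)
qed

lemma mc_init_M: "mc_init (induced_mc M \<sigma>) = (r, [])"
  by (simp add: induced_mc_def)

section \<open>Strategies versus tree models\<close>

text \<open>The history that follows a tree position by playing action \<open>0\<close> throughout.
  Positions list the innermost type first, hence the reversal.\<close>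

definition hist :: "nat list \<Rightarrow> (nat, nat) fpath" where
  "hist \<pi> = (r, rev (map (Pair 0) \<pi>))"

lemma hist_Nil: "hist [] = (r, [])" and hist_Cons: "hist (t # \<pi>) = extend_path (hist \<pi>) 0 t"
  by (simp_all add: hist_def extend_path_def)

lemma last_state_hist: "last_state (hist \<pi>) = hd (\<pi> @ [r])"
  by (cases \<pi>) (simp_all add: hist_Nil hist_Cons)

lemma last_state_hist_less: "set \<pi> \<subseteq> {..<N} \<Longrightarrow> last_state (hist \<pi>) < N"
  using root by (cases \<pi>) (auto simp: last_state_hist)

text \<open>Slot values are read off the strategy along the histories of tree positions. These are
  all reachable, because avoiding \<open>bad\<close> leaves action \<open>0\<close> as the only
  choice at a node.\<close>

lemma mc_sat_AG_imp_tree_model: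
  assumes sat: "mc_sat_AG (induced_mc M \<sigma>) (tree_formula C)"
    and ok: "\<And>t. t < N \<Longrightarrow> con_ok N K (C t)"
  shows "tree_model N r C (\<lambda>\<pi>. slot \<sigma> (hist \<pi>))"
proof -
  let ?E = "{(u, v). pmf (mc_trans (induced_mc M \<sigma>) u) v > 0}"
  define R where "R = {\<rho>. ((r, []), \<rho>) \<in> ?E\<^sup>*}"
  have satR: "sat (induced_mc M \<sigma>) \<rho> (tree_formula C)" if "\<rho> \<in> R" for \<rho>
    using sat that unfolding mc_sat_AG_def sat_AG_def mc_reachable_def R_def mc_init_M by blast
  have step: "extend_path \<rho> a s \<in> R"
    if "\<rho> \<in> R" "pmf (\<sigma> \<rho>) a > 0" "pmf (trans (last_state \<rho>) a) s > 0" for \<rho> a s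
  proof -
    have "(\<rho>, extend_path \<rho> a s) \<in> ?E" using that by (simp add: pmf_induced_mc)
    then show ?thesis using that(1) unfolding R_def by (auto intro: rtrancl_into_rtrancl)
  qed
  have det: "\<sigma> \<rho> = return_pmf 0" if "\<rho> \<in> R" "last_state \<rho> < N" for \<rho>
  proof -
    have "a = 0" if a: "a \<in> set_pmf (\<sigma> \<rho>)" for a
    proof (rule ccontr)
      assume "a \<noteq> 0"
      then have "extend_path \<rho> a bad \<in> R"
        using a \<open>\<rho> \<in> R\<close> \<open>last_state \<rho> < N\<close> by (intro step) (auto simp: trans_def pmf_positive_iff)
      from satR[OF this] show False by (simp add: sat_tree_formula)
    qed
    then have "set_pmf (\<sigma> \<rho>) \<subseteq> {0}" by auto
    then show ?thesis by (simp add: set_pmf_subset_singleton)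
  qed
  have R_hist: "hist \<pi> \<in> R" if "set \<pi> \<subseteq> {..<N}" for \<pi>
    using that
  proof (induction \<pi>)
    case Nil
    then show ?case by (simp add: hist_Nil R_def)
  next
    case (Cons t \<pi>)
    then have "last_state (hist \<pi>) < N" by (intro last_state_hist_less) simp
    with Cons show ?case
      unfolding hist_Cons
      by (intro step) (auto simp: det trans_def pmf_positive_iff node_in_succs)
  qed
  have det': "\<sigma> (hist \<pi>) = return_pmf 0" if "set \<pi> \<subseteq> {..<N}" for \<pi>
    using that by (intro det R_hist last_state_hist_less)
  show ?thesis
    unfolding tree_model_def
  proof (intro allI impI conjI)
    fix \<pi> assume \<pi>: "set \<pi> \<subseteq> {..<N}"
    note less = last_state_hist_less[OF \<pi>]
    have "sat (induced_mc M \<sigma>) (hist \<pi>) (con_formula (last_state (hist \<pi>)) (C (last_state (hist \<pi>))))"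
      using satR[OF R_hist[OF \<pi>]] less by (simp add: sat_tree_formula)
    then have "csat (slot \<sigma> (hist \<pi>)) (\<lambda>t. slot \<sigma> (extend_path (hist \<pi>) 0 t)) (C (last_state (hist \<pi>)))"
      using \<pi> less by (subst (asm) sat_con_formula) (auto simp: ok det' simp flip: hist_Cons)
    then show "csat (slot \<sigma> (hist \<pi>)) (\<lambda>t. slot \<sigma> (hist (t # \<pi>))) (C (hd (\<pi> @ [r])))"
      by (simp add: last_state_hist hist_Cons)
  qed (simp_all add: slot_def pmf_le_1)
qed

text \<open>At a gadget, the history without its last step leads to the node that owns the gadget;
  read backwards it is the tree position. The remainder modulo \<open>K\<close> is the slot.\<close>

definition tree_strategy :: "(nat list \<Rightarrow> nat \<Rightarrow> real) \<Rightarrow> (nat, nat) strategy" where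
  "tree_strategy V \<rho> =
     (let s = last_state \<rho> in
      if N \<le> s \<and> s < N + N * K
      then map_pmf of_bool (bernoulli_pmf (V (rev (map snd (butlast (snd \<rho>)))) ((s - N) mod K)))
      else return_pmf 0)"

lemma is_strategy_tree_strategy: "is_strategy M (tree_strategy V)"
  by (auto simp: is_strategy_def tree_strategy_def Let_def split: if_splits)

lemma slot_tree_strategy:
  assumes "set \<pi> \<subseteq> {..<N}" "i < K" "0 \<le> V \<pi> i" "V \<pi> i \<le> 1"
  shows "slot (tree_strategy V) (hist \<pi>) i = V \<pi> i"
proof -
  define t where "t = last_state (hist \<pi>)"
  have t: "t < N" unfolding t_def by (rule last_state_hist_less[OF assms(1)])
  have "N \<le> gadget t i" "(gadget t i - N) mod K = i" using assms(2) by (auto simp: gadget_def)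
  moreover have "rev (map snd (butlast (snd (extend_path (hist \<pi>) 0 (gadget t i))))) = \<pi>"
    by (simp add: extend_path_def hist_def rev_map comp_def)
  ultimately have "slot (tree_strategy V) (hist \<pi>) i = pmf (map_pmf of_bool (bernoulli_pmf (V \<pi> i))) (of_bool True :: nat)"
    using gadget_less[OF t assms(2)] by (simp add: slot_def tree_strategy_def flip: t_def)
  also have "\<dots> = pmf (bernoulli_pmf (V \<pi> i)) True"
    by (rule pmf_map_inj') (auto simp: inj_def)
  finally show ?thesis using assms by simp
qed

lemma tree_model_imp_mc_sat_AG:
  assumes V: "tree_model N r C V" and ok: "\<And>t. t < N \<Longrightarrow> con_ok N K (C t)"
  shows "mc_sat_AG (induced_mc M (tree_strategy V)) (tree_formula C)"
proof -
  let ?C = "induced_mc M (tree_strategy V)"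
  have det: "tree_strategy V (hist \<pi>) = return_pmf 0" if "set \<pi> \<subseteq> {..<N}" for \<pi>
    using last_state_hist_less[OF that] by (simp add: tree_strategy_def)
  \<comment> \<open>Invariant of reachable histories: the run still follows the tree, or it has left
    the nodes for good without meeting \<open>bad\<close>.\<close>
  define I where "I \<rho> \<longleftrightarrow> (\<exists>\<pi>. set \<pi> \<subseteq> {..<N} \<and> \<rho> = hist \<pi>) \<or> (N \<le> last_state \<rho> \<and> last_state \<rho> \<noteq> bad)" for \<rho>
  have I_sat: "sat ?C \<rho> (tree_formula C)" if "I \<rho>" for \<rho>
  proof (cases "\<exists>\<pi>. set \<pi> \<subseteq> {..<N} \<and> \<rho> = hist \<pi>")
    case True
    then obtain \<pi> where \<pi>: "set \<pi> \<subseteq> {..<N}" "\<rho> = hist \<pi>" by blast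
    note less = last_state_hist_less[OF \<pi>(1)]
    have V': "csat (V \<pi>) (\<lambda>t. V (t # \<pi>)) (C (last_state (hist \<pi>)))"
      and bounds: "\<And>\<pi> i. set \<pi> \<subseteq> {..<N} \<Longrightarrow> 0 \<le> V \<pi> i \<and> V \<pi> i \<le> 1"
      using V \<pi>(1) by (auto simp: tree_model_def last_state_hist)
    have "vval (slot (tree_strategy V) (hist \<pi>)) (\<lambda>t. slot (tree_strategy V) (hist (t # \<pi>))) u =
        vval (V \<pi>) (\<lambda>t. V (t # \<pi>)) u" if "var_ok N K u" for u
      using that \<pi>(1) bounds by (cases u) (auto intro!: slot_tree_strategy)
    with V' csat_cong[OF ok[OF less]]
    have "csat (slot (tree_strategy V) (hist \<pi>)) (\<lambda>t. slot (tree_strategy V) (hist (t # \<pi>))) (C (last_state (hist \<pi>)))"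
      by blast
    then have "sat ?C (hist \<pi>) (con_formula (last_state (hist \<pi>)) (C (last_state (hist \<pi>))))"
      using \<pi>(1) less by (subst sat_con_formula) (auto simp: ok det simp flip: hist_Cons)
    with less show ?thesis by (simp add: sat_tree_formula \<pi>(2) bad_def dead_def)
  next
    case False
    with that show ?thesis by (auto simp: I_def sat_tree_formula)
  qed
  have I_step: "I \<rho>'" if step: "I \<rho>" "pmf (mc_trans ?C \<rho>) \<rho>' > 0" for \<rho> \<rho>'
  proof -
    obtain a s where a: "a \<in> set_pmf (tree_strategy V \<rho>)" and s: "s \<in> set_pmf (trans (last_state \<rho>) a)"
      and \<rho>': "\<rho>' = extend_path \<rho> a s"
      using step(2) by (auto simp: pmf_positive_iff induced_mc_def)
    show ?thesis
    proof (cases "\<exists>\<pi>. set \<pi> \<subseteq> {..<N} \<and> \<rho> = hist \<pi>")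
      case True
      then obtain \<pi> where \<pi>: "set \<pi> \<subseteq> {..<N}" "\<rho> = hist \<pi>" by blast
      note less = last_state_hist_less[OF \<pi>(1)]
      have a0: "a = 0" using a det[OF \<pi>(1)] \<pi>(2) by simp
      have s': "s \<in> succs (last_state (hist \<pi>))" using s less a0 \<pi>(2) by (simp add: trans_def)
      show ?thesis
      proof (cases "s < N")
        case True
        then have "set (s # \<pi>) \<subseteq> {..<N}" "\<rho>' = hist (s # \<pi>)"
          using \<pi> a0 by (auto simp: \<rho>' hist_Cons)
        then show ?thesis unfolding I_def by blast
      next
        case False
        then show ?thesis using succs_less[OF less s'] by (simp add: I_def \<rho>' bad_def dead_def)
      qed
    next
      case False
      with step(1) have "N \<le> last_state \<rho>" by (simp add: I_def)
      then show ?thesis using s by (auto simp: I_def \<rho>' trans_def bad_def dead_def split: if_splits)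
    qed
  qed
  have "I \<rho>" if "((r, []), \<rho>) \<in> {(u, v). pmf (mc_trans ?C u) v > 0}\<^sup>*" for \<rho>
    using that
  proof (induction rule: rtrancl_induct)
    case base
    then show ?case unfolding I_def by (metis hist_Nil empty_subsetI list.set(1))
  qed (auto intro: I_step)
  then show ?thesis
    using I_sat unfolding mc_sat_AG_def sat_AG_def mc_reachable_def mc_init_M by blast
qed

theorem synthesis_iff_tree_model:
  assumes "\<And>t. t < N \<Longrightarrow> con_ok N K (C t)"
  shows "(\<exists>\<sigma>. is_strategy M \<sigma> \<and> mc_sat_AG (induced_mc M \<sigma>) (tree_formula C)) \<longleftrightarrow>
    (\<exists>V. tree_model N r C V)"
  using mc_sat_AG_imp_tree_model tree_model_imp_mc_sat_AG is_strategy_tree_strategy assms by metis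

section \<open>Independence of the values that an instance code does not record\<close>

lemma sat_con_formula_agree:
  fixes C C' :: "('s :: countable, nat) mc"
  assumes "mc_agree C C' S" "s \<in> S"
  shows "sat C s (con_formula t c) \<longleftrightarrow> sat C' s (con_formula t c)"
proof (induction c)
  case (Lin ts c)
  have "map (\<lambda>x. case lin_term t x of (a, \<phi>) \<Rightarrow>
        real_of_int a * measure (path_measure (mc_trans C) s) {\<omega>. psat C \<omega> \<phi>}) ts =
      map (\<lambda>x. case lin_term t x of (a, \<phi>) \<Rightarrow>
        real_of_int a * measure (path_measure (mc_trans C') s) {\<omega>. psat C' \<omega> \<phi>}) ts"
  proof (intro map_cong refl)
    fix x
    obtain l y where "snd (lin_term t x) = Next l (Atom y)" using lin_term_cases[of t x] by blast
    then show "(case lin_term t x of (a, \<phi>) \<Rightarrow>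
        real_of_int a * measure (path_measure (mc_trans C) s) {\<omega>. psat C \<omega> \<phi>}) =
      (case lin_term t x of (a, \<phi>) \<Rightarrow>
        real_of_int a * measure (path_measure (mc_trans C') s) {\<omega>. psat C' \<omega> \<phi>})"
      using measure_Next_Atom_agree[OF assms, of l y] by (simp add: case_prod_beta del: psat.simps)
  qed
  then show ?case by (simp only: con_formula.simps sat.simps compare.simps map_map comp_def)
qed auto

lemma sat_tree_formula_agree:
  fixes C C' :: "('s :: countable, nat) mc"
  assumes "mc_agree C C' S" "s \<in> S"
  shows "sat C s (tree_formula \<Gamma>) \<longleftrightarrow> sat C' s (tree_formula \<Gamma>)"
proof -
  have "mc_label C s = mc_label C' s" using assms by (simp add: mc_agree_def)
  then have "sat C s (foldr (\<lambda>t. Conj (Disj (NegAtom t) (con_formula t (\<Gamma> t)))) ts (NegAtom bad)) \<longleftrightarrow>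
      sat C' s (foldr (\<lambda>t. Conj (Disj (NegAtom t) (con_formula t (\<Gamma> t)))) ts (NegAtom bad))" for ts
    by (induction ts) (auto simp: sat_con_formula_agree[OF assms])
  then show ?thesis by (simp add: tree_formula_def)
qed

text \<open>The strategy is kept. Runs under \<open>M\<close> stay in the closed set of finite paths
  of \<open>M\<close>, where both chains make the same steps, so whatever is reachable under
  \<open>M\<close> is reachable under \<open>M'\<close>.\<close>

lemma synthesis_agree:
  assumes M': "mdp_agree M M'" and \<sigma>: "is_strategy M' \<sigma>"
    and sat: "mc_sat_AG (induced_mc M' \<sigma>) (tree_formula \<Gamma>)"
  shows "is_strategy M \<sigma> \<and> mc_sat_AG (induced_mc M \<sigma>) (tree_formula \<Gamma>)"
proof
  show \<sigma>': "is_strategy M \<sigma>"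
    by (rule mdp_agree_is_strategy[OF M' \<sigma>])
  have agree: "mc_agree (induced_mc M \<sigma>) (induced_mc M' \<sigma>) (finite_paths M)"
    using standard_mdp_M by (intro mc_agree_induced_mc M' \<sigma>') (simp add: standard_mdp_def)
  let ?E = "\<lambda>M. {(u, v). pmf (mc_trans (induced_mc M \<sigma>) u) v > 0}"
  have init: "mc_init (induced_mc M \<sigma>) \<in> finite_paths M" "mc_init (induced_mc M' \<sigma>) = mc_init (induced_mc M \<sigma>)"
    using standard_mdp_M M'
    by (auto simp: induced_mc_def mdp_agree_def standard_mdp_def markov_decision_process_def simp del: M_simps
        intro: finite_paths.single)
  have "(mc_init (induced_mc M \<sigma>), \<rho>) \<in> (?E M')\<^sup>* \<and> \<rho> \<in> finite_paths M"
    if "(mc_init (induced_mc M \<sigma>), \<rho>) \<in> (?E M)\<^sup>*" for \<rho>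
    using that
  proof (induction rule: rtrancl_induct)
    case base
    then show ?case using init by simp
  next
    case (step \<rho> \<rho>')
    then have "mc_trans (induced_mc M \<sigma>) \<rho> = mc_trans (induced_mc M' \<sigma>) \<rho>"
      "set_pmf (mc_trans (induced_mc M \<sigma>) \<rho>) \<subseteq> finite_paths M"
      using agree step.IH unfolding mc_agree_def by blast+
    with step.hyps(2) have "(\<rho>, \<rho>') \<in> ?E M'" "\<rho>' \<in> finite_paths M"
      by (auto simp: pmf_positive_iff)
    with step.IH show ?case by (blast intro: rtrancl_into_rtrancl)
  qed
  then show "mc_sat_AG (induced_mc M \<sigma>) (tree_formula \<Gamma>)"
    using sat sat_tree_formula_agree[OF agree]
    unfolding mc_sat_AG_def sat_AG_def mc_reachable_def init(2) by blast
qed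

text \<open>Membership of the code may be witnessed by an MDP other than \<open>M\<close>.
  Injectivity of the encoding makes it agree with \<open>M\<close>, and
  \<open>synthesis_agree\<close> carries its strategy over.\<close>

lemma instance_iff_tree_model:
  assumes ok: "\<And>t. t < N \<Longrightarrow> con_ok N K (\<Gamma> t)"
  shows "encode_instance M (tree_formula \<Gamma>) \<in>
    {encode_instance M \<Phi> | (M :: (nat, nat, nat) mdp) (\<Phi> :: nat sformula).
       standard_mdp M \<and> wf_sformula \<Phi> \<and> atoms \<Phi> \<subseteq> AP M \<and>
       window \<Phi> \<and> flat_formula \<Phi> \<and> non_strict \<Phi> \<and>
       (\<exists>\<sigma>. is_strategy M \<sigma> \<and> mc_sat_AG (induced_mc M \<sigma>) \<Phi>)} \<longleftrightarrow>
    (\<exists>V. tree_model N r \<Gamma> V)" (is "_ \<in> ?B \<longleftrightarrow> _")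
proof
  assume "encode_instance M (tree_formula \<Gamma>) \<in> ?B"
  then obtain M' \<Phi> \<sigma> where eq: "encode_instance M (tree_formula \<Gamma>) = encode_instance M' \<Phi>"
    and M': "standard_mdp M'" and \<sigma>: "is_strategy M' \<sigma>" "mc_sat_AG (induced_mc M' \<sigma>) \<Phi>"
    by blast
  note inj = encode_instance_inject[OF standard_mdp_M M' eq]
  have "mdp_agree M M'" unfolding mdp_agree_def using inj by blast
  then show "\<exists>V. tree_model N r \<Gamma> V"
    using synthesis_agree[of M' \<sigma> \<Gamma>] \<sigma> inj(1) synthesis_iff_tree_model[of \<Gamma>, OF ok] by blast
next
  assume "\<exists>V. tree_model N r \<Gamma> V"
  then show "encode_instance M (tree_formula \<Gamma>) \<in> ?B"
    using synthesis_iff_tree_model[of \<Gamma>, OF ok] standard_mdp_M tree_formula_props[of \<Gamma>, OF ok] by blast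
qed

end

section \<open>Evaluation of recursive functions as a tree of constraints\<close>

text \<open>A linear combination must have a summand, hence the zero coefficient on an arbitrary
  slot.\<close>

definition true_con :: con where
  "true_con = Lin [(0, Own 0)] 0"

definition false_con :: con where
  "false_con = Lin [(0, Own 0)] 1"

definition eq_con :: "int \<Rightarrow> var \<Rightarrow> int \<Rightarrow> var \<Rightarrow> con" where
  "eq_con a u b w = And (Lin [(a, u), (- b, w)] 0) (Lin [(- a, u), (b, w)] 0)"

definition const_con :: "int \<Rightarrow> var \<Rightarrow> int \<Rightarrow> con" where
  "const_con a u c = And (Lin [(a, u)] c) (Lin [(- a, u)] (- c))"

text \<open>Among codes of defined values this singles out the positive ones: \<open>0\<close> has
  code \<open>1\<close>, all others have code at most one half.\<close>

definition half_con :: "var \<Rightarrow> con" where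
  "half_con u = Lin [(- 2, u)] (- 1)"

definition all_con :: "con list \<Rightarrow> con" where
  "all_con cs = foldr And cs true_con"

definition any_con :: "con list \<Rightarrow> con" where
  "any_con cs = foldr Or cs false_con"

definition copy_con :: "nat \<Rightarrow> (nat \<Rightarrow> var) \<Rightarrow> (nat \<Rightarrow> var) \<Rightarrow> con" where
  "copy_con n u w = all_con (map (\<lambda>k. eq_con 1 (u k) 1 (w k)) [0..<n])"

lemma csat_simps [simp]:
  "csat v w true_con"
  "\<not> csat v w false_con"
  "csat v w (eq_con a u b z) \<longleftrightarrow> a * vval v w u = b * vval v w z"
  "csat v w (const_con a u c) \<longleftrightarrow> a * vval v w u = c"
  "csat v w (half_con u) \<longleftrightarrow> vval v w u \<le> 1 / 2"
  by (auto simp: true_con_def false_con_def eq_con_def const_con_def half_con_def)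

lemma csat_all_con [simp]: "csat v w (all_con cs) \<longleftrightarrow> (\<forall>c\<in>set cs. csat v w c)"
  by (induction cs) (auto simp: all_con_def)

lemma csat_any_con [simp]: "csat v w (any_con cs) \<longleftrightarrow> (\<exists>c\<in>set cs. csat v w c)"
  by (induction cs) (auto simp: any_con_def)

lemma csat_copy_con [simp]:
  "csat v w (copy_con n u z) \<longleftrightarrow> (\<forall>k<n. vval v w (u k) = vval v w (z k))"
  by (auto simp: copy_con_def)

lemma con_ok_simps [simp]:
  "con_ok N K true_con \<longleftrightarrow> 0 < K"
  "con_ok N K false_con \<longleftrightarrow> 0 < K"
  "con_ok N K (eq_con a u b z) \<longleftrightarrow> var_ok N K u \<and> var_ok N K z"
  "con_ok N K (const_con a u c) \<longleftrightarrow> var_ok N K u"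
  "con_ok N K (half_con u) \<longleftrightarrow> var_ok N K u"
  by (auto simp: true_con_def false_con_def eq_con_def const_con_def half_con_def)

lemma con_ok_all_con [simp]: "con_ok N K (all_con cs) \<longleftrightarrow> 0 < K \<and> (\<forall>c\<in>set cs. con_ok N K c)"
  by (induction cs) (auto simp: all_con_def)

lemma con_ok_any_con [simp]: "con_ok N K (any_con cs) \<longleftrightarrow> 0 < K \<and> (\<forall>c\<in>set cs. con_ok N K c)"
  by (induction cs) (auto simp: any_con_def)

lemma con_ok_copy_con [simp]:
  "con_ok N K (copy_con n u z) \<longleftrightarrow> 0 < K \<and> (\<forall>k<n. var_ok N K (u k) \<and> var_ok N K (z k))"
  by (auto simp: copy_con_def)

text \<open>A call \<open>(tag, g, n)\<close> of the subprogram \<open>g\<close> with \<open>n\<close> arguments has its result in slot \<open>0\<close> and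
  its arguments in slots \<open>1, \<dots>, n\<close>. Tags \<open>0\<close> and \<open>1\<close> are two copies of an ordinary call: a
  composition may call the same subprogram with different arguments as inner and as outer
  function, and a node has only one child of each type. Tag \<open>2\<close> is the unbounded search for a zero
  of \<open>g\<close> starting from the first argument, and tag \<open>3\<close> is the root.\<close>

type_synonym call = "nat \<times> recf \<times> nat"

fun arity :: "call \<Rightarrow> nat" where
  "arity (tag, g, n) = n"

text \<open>Halving a code is the successor, doubling it the predecessor. A wrong number of
  arguments, for which no evaluation rule applies, leaves the result free. Equal inner functions of
  a composition share a child, which is harmless as their arguments coincide.\<close>

fun body_con :: "(call \<Rightarrow> nat) \<Rightarrow> recf \<Rightarrow> nat \<Rightarrow> con" where
  "body_con ix Zero n = const_con 1 (Own 0) 1"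
| "body_con ix Succ n = (if n = 1 then eq_con 2 (Own 0) 1 (Own 1) else true_con)"
| "body_con ix (Proj i) n = (if i < n then eq_con 1 (Own 0) 1 (Own (Suc i)) else true_con)"
| "body_con ix (Comp f gs) n =
     (let l = length gs; h = ix (1, f, l) in
      all_con
       [all_con (map (\<lambda>g. copy_con n (\<lambda>k. Chd (ix (0, g, n)) (Suc k)) (\<lambda>k. Own (Suc k))) gs),
        copy_con l (\<lambda>j. Chd h (Suc j)) (\<lambda>j. Chd (ix (0, gs ! j, n)) 0),
        eq_con 1 (Chd h 0) 1 (Own 0)])"
| "body_con ix (PrimRec f g) n =
     (case n of 0 \<Rightarrow> true_con
      | Suc m \<Rightarrow>
        let b = ix (0, f, m); s = ix (0, PrimRec f g, n); h = ix (1, g, Suc n) in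
        Or (all_con
             [const_con 1 (Own 1) 1,
              copy_con m (\<lambda>k. Chd b (Suc k)) (\<lambda>k. Own (Suc (Suc k))),
              eq_con 1 (Chd b 0) 1 (Own 0)])
           (all_con
             [half_con (Own 1),
              eq_con 1 (Chd s 1) 2 (Own 1),
              copy_con m (\<lambda>k. Chd s (Suc (Suc k))) (\<lambda>k. Own (Suc (Suc k))),
              eq_con 1 (Chd h 1) 2 (Own 1),
              eq_con 1 (Chd h 2) 1 (Chd s 0),
              copy_con m (\<lambda>k. Chd h (Suc (Suc (Suc k)))) (\<lambda>k. Own (Suc (Suc k))),
              eq_con 1 (Chd h 0) 1 (Own 0)]))"
| "body_con ix (Mu f) n =
     (let s = ix (2, f, Suc n) in
      all_con
       [const_con 1 (Chd s 1) 1,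
        copy_con n (\<lambda>k. Chd s (Suc (Suc k))) (\<lambda>k. Own (Suc k)),
        eq_con 1 (Chd s 0) 1 (Own 0)])"

text \<open>The alternatives are that the tested value is undefined, zero or positive. In the last
  case the result is copied from the search at the successor, so an endless search does not
  determine it.\<close>

definition search_con :: "(call \<Rightarrow> nat) \<Rightarrow> recf \<Rightarrow> nat \<Rightarrow> con" where
  "search_con ix g n =
     (case n of 0 \<Rightarrow> true_con
      | Suc m \<Rightarrow>
        let c = ix (0, g, n); s = ix (2, g, n) in
        And (copy_con n (\<lambda>k. Chd c (Suc k)) (\<lambda>k. Own (Suc k)))
         (any_con
           [const_con 1 (Chd c 0) 0,
            And (const_con 1 (Chd c 0) 1) (eq_con 1 (Own 0) 1 (Own 1)),
            all_con
             [half_con (Chd c 0),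
              eq_con 2 (Chd s 1) 1 (Own 1),
              copy_con m (\<lambda>k. Chd s (Suc (Suc k))) (\<lambda>k. Own (Suc (Suc k))),
              eq_con 1 (Chd s 0) 1 (Own 0)]]))"

text \<open>Nothing is required of a call with an undefined argument.\<close>

definition guard_con :: "nat \<Rightarrow> con \<Rightarrow> con" where
  "guard_con n c = Or (any_con (map (\<lambda>k. const_con 1 (Own (Suc k)) 0) [0..<n])) c"

text \<open>The root demands that its child, the call of \<open>f\<close>, has the code of
  \<open>x\<close> as argument and claims to be undefined. Multiplying by \<open>2 ^ x\<close> makes
  the first demand integral.\<close>

fun call_con :: "(call \<Rightarrow> nat) \<Rightarrow> recf \<Rightarrow> nat \<Rightarrow> call \<Rightarrow> con" where
  "call_con ix f x (tag, g, n) =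
     (if tag = 3 then
        And (const_con (2 ^ x) (Chd (ix (0, f, 1)) 1) 1) (const_con 1 (Chd (ix (0, f, 1)) 0) 0)
      else guard_con n (if tag = 2 then search_con ix g n else body_con ix g n))"

section \<open>The finite set of calls\<close>

text \<open>The syntax determines how many arguments each subprogram receives, so finitely many
  pairs suffice even when the evaluation does not end.\<close>

fun subcalls :: "recf \<Rightarrow> nat \<Rightarrow> (recf \<times> nat) set" where
  "subcalls (Comp f gs) n =
     insert (Comp f gs, n) (subcalls f (length gs) \<union> (\<Union>g\<in>set gs. subcalls g n))"
| "subcalls (PrimRec f g) n =
     insert (PrimRec f g, n) (subcalls f (n - 1) \<union> subcalls g (Suc n))"
| "subcalls (Mu f) n = insert (Mu f, n) (subcalls f (Suc n))"
| "subcalls f n = {(f, n)}"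

lemma subcalls_self: "(f, n) \<in> subcalls f n"
  by (cases f) auto

lemma finite_subcalls: "finite (subcalls f n)"
  by (induction f n rule: subcalls.induct) auto

lemma subcalls_trans: "(g, m) \<in> subcalls f n \<Longrightarrow> subcalls g m \<subseteq> subcalls f n"
  by (induction f n rule: subcalls.induct) auto

definition calls :: "recf \<Rightarrow> call set" where
  "calls f = {..<4} \<times> subcalls f 1"

lemma finite_calls: "finite (calls f)"
  by (simp add: calls_def finite_subcalls)

lemma calls_root: "tag < 4 \<Longrightarrow> (tag, f, 1) \<in> calls f"
  using subcalls_self by (simp add: calls_def)

lemma calls_retag: "(tag, g, n) \<in> calls f \<Longrightarrow> tag' < 4 \<Longrightarrow> (tag', g, n) \<in> calls f"
  by (simp add: calls_def)

lemma calls_sub: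
  assumes "(tag, g, n) \<in> calls f" "(h, m) \<in> subcalls g n" "tag' < 4"
  shows "(tag', h, m) \<in> calls f"
  using assms subcalls_trans[of g n f 1] by (auto simp: calls_def)

lemma calls_Comp:
  assumes "(tag, Comp h gs, n) \<in> calls f" "tag' < 4"
  shows "(tag', h, length gs) \<in> calls f" "g \<in> set gs \<Longrightarrow> (tag', g, n) \<in> calls f"
  by (rule calls_sub[OF assms(1) _ assms(2)]; use subcalls_self in auto)+

lemma calls_PrimRec:
  assumes "(tag, PrimRec h g, n) \<in> calls f" "tag' < 4"
  shows "n = Suc m \<Longrightarrow> (tag', h, m) \<in> calls f" "(tag', g, Suc n) \<in> calls f"
  using assms subcalls_self by (auto intro!: calls_sub[OF assms(1)])

lemma calls_Mu:
  assumes "(tag, Mu h, n) \<in> calls f" "tag' < 4"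
  shows "(tag', h, Suc n) \<in> calls f"
  using assms subcalls_self by (auto intro!: calls_sub[OF assms(1)])

section \<open>The true partial semantics of calls\<close>

text \<open>The value is the zero itself and not its distance from the start \<open>i\<close>; it
  therefore stays the same along the whole search.\<close>

definition mu_from :: "recf \<Rightarrow> nat list \<Rightarrow> nat \<Rightarrow> bool" where
  "mu_from g ns y \<longleftrightarrow>
     (\<exists>i xs. ns = i # xs \<and> i \<le> y \<and> reval g (y # xs) 0 \<and>
       (\<forall>j. i \<le> j \<and> j < y \<longrightarrow> (\<exists>z. reval g (j # xs) (Suc z))))"

lemma reval_Comp_iff:
  "reval (Comp f gs) xs z \<longleftrightarrow>
     (\<exists>ys. length ys = length gs \<and> (\<forall>i<length gs. reval (gs ! i) xs (ys ! i)) \<and> reval f ys z)"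
  by (auto elim: reval.cases intro: reval.Comp)

lemma reval_PrimRec_0_iff: "reval (PrimRec f g) (0 # xs) y \<longleftrightarrow> reval f xs y"
  by (auto elim: reval.cases intro: reval.PrimRec_0)

lemma reval_PrimRec_Suc_iff:
  "reval (PrimRec f g) (Suc n # xs) z \<longleftrightarrow>
     (\<exists>y. reval (PrimRec f g) (n # xs) y \<and> reval g (n # y # xs) z)"
  by (auto elim: reval.cases intro: reval.PrimRec_Suc)

lemma reval_Mu_iff: "reval (Mu f) xs n \<longleftrightarrow> mu_from f (0 # xs) n"
  by (auto simp: mu_from_def elim: reval.cases intro: reval.Mu)

text \<open>Together with \<open>mu_from_Suc\<close> this unfolds one step of a search and justifies
  the last two alternatives of \<open>search_con\<close>.\<close>

lemma mu_from_0: "reval g (i # xs) 0 \<Longrightarrow> mu_from g (i # xs) y \<longleftrightarrow> y = i"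
  by (auto simp: mu_from_def) (metis le_neq_implies_less nat.simps(3) order_refl reval_functional)

lemma mu_from_Suc: "reval g (i # xs) (Suc z) \<Longrightarrow> mu_from g (i # xs) y \<longleftrightarrow> mu_from g (Suc i # xs) y"
  unfolding mu_from_def
  by (auto simp: Suc_le_eq)
     (metis le_neq_implies_less nat.simps(3) reval_functional, metis le_neq_implies_less)

lemma mu_from_functional:
  assumes "mu_from g ns y" "mu_from g ns y'"
  shows "y = y'"
proof (rule linorder_cases[of y y'])
  assume "y < y'"
  with assms obtain z i xs where "reval g (y # xs) 0" "reval g (y # xs) (Suc z)"
    unfolding mu_from_def by auto
  then show ?thesis using reval_functional by fastforce
next
  assume "y' < y"
  with assms obtain z i xs where "reval g (y' # xs) 0" "reval g (y' # xs) (Suc z)"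
    unfolding mu_from_def by auto
  then show ?thesis using reval_functional by fastforce
qed simp

fun call_rel :: "call \<Rightarrow> nat list \<Rightarrow> nat \<Rightarrow> bool" where
  "call_rel (tag, g, n) ns y \<longleftrightarrow> (if tag = 2 then mu_from g ns y else reval g ns y)"

lemma call_rel_functional: "call_rel t ns y \<Longrightarrow> call_rel t ns y' \<Longrightarrow> y = y'"
  by (cases t) (auto split: if_splits dest: mu_from_functional reval_functional)

text \<open>A strict extension to undefined arguments: they make the result undefined even when the
  function ignores them. This matches \<open>reval\<close>, which evaluates all inner functions of a
  composition.\<close>

definition sem :: "call \<Rightarrow> nat option list \<Rightarrow> nat option" where
  "sem t as =
     (if \<exists>ns y. as = map Some ns \<and> call_rel t ns y
      then Some (THE y. call_rel t (map the as) y) else None)"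

lemma sem_eq_Some_iff: "sem t (map Some ns) = Some y \<longleftrightarrow> call_rel t ns y"
proof -
  have "map Some ns = map Some ns' \<longleftrightarrow> ns = ns'" for ns' :: "nat list"
    by (simp add: inj_map_eq_map)
  moreover have "map the (map Some ns) = ns" by (simp add: comp_def)
  ultimately show ?thesis
    unfolding sem_def by (auto intro: theI call_rel_functional the_equality)
qed

lemma sem_None: "None \<in> set as \<Longrightarrow> sem t as = None"
  by (auto simp: sem_def)

lemma sem_eqI:
  "(\<And>y. call_rel t ns y \<longleftrightarrow> call_rel t' ns' y) \<Longrightarrow> sem t (map Some ns) = sem t' (map Some ns')"
  using sem_eq_Some_iff by (metis option.exhaust)

fun code :: "nat option \<Rightarrow> real" where
  "code None = 0"
| "code (Some n) = (1 / 2) ^ n"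

lemma code_bounds: "0 \<le> code a" "code a \<le> 1"
  by (cases a; simp add: power_le_one)+

definition slot_val :: "call \<Rightarrow> nat option list \<Rightarrow> nat \<Rightarrow> real" where
  "slot_val t as i =
     code (case i of 0 \<Rightarrow> sem t as | Suc k \<Rightarrow> if k < length as then as ! k else None)"

lemma slot_val_0 [simp]: "slot_val t as 0 = code (sem t as)"
  and slot_val_Suc [simp]: "k < length as \<Longrightarrow> slot_val t as (Suc k) = code (as ! k)"
  by (simp_all add: slot_val_def)

lemma not_None_imp_map_Some: "None \<notin> set as \<Longrightarrow> \<exists>ns. as = map Some ns"
proof
  assume "None \<notin> set as"
  then have "map (\<lambda>a. Some (the a)) as = as" by (intro map_idI) (metis option.collapse)
  then show "as = map Some (map the as)" by (simp add: comp_def)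
qed

text \<open>If an inner result is undefined, both sides are undefined by strictness; otherwise the
  inner results are unique, so the outer call receives the right arguments.\<close>

lemma sem_Comp:
  "sem (1, h, length gs) (map (\<lambda>g. sem (0, g, n) (map Some ns)) gs) = sem (tag, Comp h gs, n) (map Some ns)"
  if "tag < 2"
proof (cases "None \<in> set (map (\<lambda>g. sem (0, g, n) (map Some ns)) gs)")
  case True
  then obtain g where g: "g \<in> set gs" "sem (0, g, n) (map Some ns) = None" by auto
  then have "\<not> reval g ns y" for y using sem_eq_Some_iff[of "(0, g, n)" ns y] by auto
  then have "\<not> reval (Comp h gs) ns y" for y
    using g(1) unfolding reval_Comp_iff in_set_conv_nth by metis
  then have "sem (tag, Comp h gs, n) (map Some ns) = None"
    using sem_eq_Some_iff[of "(tag, Comp h gs, n)" ns] that by (cases "sem (tag, Comp h gs, n) (map Some ns)") auto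
  then show ?thesis using sem_None[OF True] by simp
next
  case False
  then obtain ys where ys: "map (\<lambda>g. sem (0, g, n) (map Some ns)) gs = map Some ys"
    using not_None_imp_map_Some by blast
  then have len: "length ys = length gs" by (metis length_map)
  have ev: "reval (gs ! i) ns (ys ! i)" if "i < length gs" for i
    using arg_cong[OF ys, of "\<lambda>l. l ! i"] that len sem_eq_Some_iff[of "(0, gs ! i, n)" ns "ys ! i"] by simp
  have "reval (Comp h gs) ns y \<longleftrightarrow> reval h ys y" for y
  proof
    assume "reval (Comp h gs) ns y"
    then obtain ys' where ys': "length ys' = length gs" "\<forall>i<length gs. reval (gs ! i) ns (ys' ! i)" "reval h ys' y"
      unfolding reval_Comp_iff by blast
    have "ys' = ys" using ys' ev len by (intro nth_equalityI) (auto intro: reval_functional)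
    with ys' show "reval h ys y" by simp
  qed (use ev len in \<open>auto simp: reval_Comp_iff\<close>)
  then show ?thesis unfolding ys using that by (intro sem_eqI) auto
qed

lemma sem_PrimRec_Suc:
  assumes "tag < 2"
  shows "sem (1, g, l) (Some b # sem (0, PrimRec h g, m) (map Some (b # r)) # map Some r) =
    sem (tag, PrimRec h g, n) (map Some (Suc b # r))"
proof (cases "sem (0, PrimRec h g, m) (map Some (b # r))")
  case None
  then have "\<not> reval (PrimRec h g) (b # r) y" for y
    using sem_eq_Some_iff[of "(0, PrimRec h g, m)" "b # r" y] by auto
  then have "sem (tag, PrimRec h g, n) (map Some (Suc b # r)) \<noteq> Some y" for y
    unfolding sem_eq_Some_iff using assms by (simp add: reval_PrimRec_Suc_iff)
  then show ?thesis using None by (simp add: sem_None) (metis option.exhaust)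
next
  case (Some y)
  then have "reval (PrimRec h g) (b # r) y"
    using sem_eq_Some_iff[of "(0, PrimRec h g, m)" "b # r" y] by simp
  then have "reval (PrimRec h g) (Suc b # r) z \<longleftrightarrow> reval g (b # y # r) z" for z
    unfolding reval_PrimRec_Suc_iff using reval_functional by blast
  then have "sem (1, g, l) (map Some (b # y # r)) = sem (tag, PrimRec h g, n) (map Some (Suc b # r))"
    using assms by (intro sem_eqI) auto
  with Some show ?thesis by simp
qed

text \<open>Default arguments for children that the constraint at hand does not mention.\<close>

definition none_args :: "call \<Rightarrow> nat option list" where
  "none_args t = replicate (arity t) None"

lemma length_none_args [simp]: "length (none_args t) = arity t"
  by (simp add: none_args_def)

locale call_tree =
  fixes f :: recf and ty :: "nat \<Rightarrow> call" and ix :: "call \<Rightarrow> nat" and N :: nat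
  assumes ty_calls: "j < N \<Longrightarrow> ty j \<in> calls f"
    and ix_less: "t \<in> calls f \<Longrightarrow> ix t < N"
    and ty_ix: "t \<in> calls f \<Longrightarrow> ty (ix t) = t"
begin

definition root :: nat where
  "root = ix (3, f, 1)"

lemma root_less: "root < N"
  unfolding root_def by (intro ix_less calls_root) simp

text \<open>Slot \<open>0\<close> holds the result and the arguments follow, so \<open>K\<close>
  must exceed every arity. Child types stay below \<open>N\<close> because \<open>calls f\<close> is
  closed under subcalls.\<close>

lemma con_ok_call_con:
  assumes K: "\<And>t. t \<in> calls f \<Longrightarrow> arity t < K" and t: "t \<in> calls f"
  shows "con_ok N K (call_con ix f x t)"
proof -
  obtain tag g n where t': "t = (tag, g, n)" by (cases t)
  have n: "n < K" using K[OF t] t' by simp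
  have root': "var_ok N K (Chd (ix (0, f, 1)) i)" if "i \<le> 1" for i
    using that ix_less[OF calls_root[of 0]] K[OF calls_root[of 0]] by simp
  have ch: "var_ok N K (Chd (ix (tag', h, m)) i)" if "(tag', h, m) \<in> calls f" "i \<le> m" for tag' h m i
    using ix_less[OF that(1)] K[OF that(1)] that(2) by simp
  have "con_ok N K (body_con ix g n)"
  proof (cases g)
    case (Comp h gs)
    note C = calls_Comp[OF t[unfolded t' Comp]]
    show ?thesis using n by (auto simp: Comp Let_def simp del: var_ok.simps(2) intro!: ch C)
  next
    case (PrimRec h g')
    show ?thesis
    proof (cases n)
      case (Suc m)
      note C = calls_PrimRec[OF t[unfolded t' PrimRec Suc]] calls_retag[OF t[unfolded t' PrimRec Suc]]
      show ?thesis
        using n by (auto simp: PrimRec Suc Let_def simp del: var_ok.simps(2) intro!: ch C)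
    qed (use n in \<open>simp add: PrimRec\<close>)
  next
    case (Mu h)
    note C = calls_Mu[OF t[unfolded t' Mu]]
    show ?thesis using n by (auto simp: Mu Let_def simp del: var_ok.simps(2) intro!: ch C)
  qed (use n in auto)
  moreover have "con_ok N K (search_con ix g n)"
    using n calls_retag[OF t[unfolded t']]
    by (auto simp: search_con_def Let_def simp del: var_ok.simps(2) split: nat.split intro!: ch)
  ultimately show ?thesis
    using n root'[of 0] root'[of 1] by (simp add: t' guard_con_def)
qed

section \<open>Soundness: a tree model gives terminating calls their true value\<close>

context
  fixes x :: nat and V :: "nat list \<Rightarrow> nat \<Rightarrow> real"
  assumes model: "tree_model N root (\<lambda>j. call_con ix f x (ty j)) V"
begin

definition at_call :: "nat list \<Rightarrow> call \<Rightarrow> bool" where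
  "at_call \<pi> t \<longleftrightarrow> set \<pi> \<subseteq> {..<N} \<and> ty (hd (\<pi> @ [root])) = t"

definition args :: "nat list \<Rightarrow> nat list \<Rightarrow> bool" where
  "args \<pi> ns \<longleftrightarrow> (\<forall>k<length ns. V \<pi> (Suc k) = code (Some (ns ! k)))"

lemma at_child: "at_call \<pi> t \<Longrightarrow> t' \<in> calls f \<Longrightarrow> at_call (ix t' # \<pi>) t'"
  by (simp add: at_call_def ix_less ty_ix)

lemma at_calls: "at_call \<pi> t \<Longrightarrow> t \<in> calls f"
  unfolding at_call_def using ty_calls[OF root_less] ty_calls by (cases \<pi>) auto

lemma at_csat: "at_call \<pi> t \<Longrightarrow> csat (V \<pi>) (\<lambda>j. V (j # \<pi>)) (call_con ix f x t)"
  using model by (auto simp: at_call_def tree_model_def)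

lemma args_Cons: "args \<pi> (a # ns) \<longleftrightarrow> V \<pi> 1 = code (Some a) \<and> (\<forall>k<length ns. V \<pi> (Suc (Suc k)) = code (Some (ns ! k)))"
  by (auto simp: args_def All_less_Suc2)

lemma csat_guard:
  "args \<pi> ns \<Longrightarrow> n = length ns \<Longrightarrow> csat (V \<pi>) w (guard_con n c) \<Longrightarrow> csat (V \<pi>) w c"
  by (auto simp: guard_con_def args_def)

lemma at_body:
  assumes "at_call \<pi> (tag, g, n)" "tag < 2" "args \<pi> ns" "n = length ns"
  shows "csat (V \<pi>) (\<lambda>j. V (j # \<pi>)) (body_con ix g n)"
  using at_csat[OF assms(1)] assms(2) csat_guard[OF assms(3,4)] by simp

lemma at_search:
  assumes "at_call \<pi> (2, g, n)" "args \<pi> ns" "n = length ns"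
  shows "csat (V \<pi>) (\<lambda>j. V (j # \<pi>)) (search_con ix g n)"
  using at_csat[OF assms(1)] csat_guard[OF assms(2,3)] by simp

text \<open>Induction on the evaluation, not on the tree, which is infinite. Defined arguments have
  nonzero codes, so the guard offers no escape. The position is arbitrary because a call can occur
  at many places.\<close>

lemma model_sound:
  assumes "reval g ns y" "tag < 2" "at_call \<pi> (tag, g, length ns)" "args \<pi> ns"
  shows "V \<pi> 0 = code (Some y)"
  using assms
proof (induction arbitrary: tag \<pi> rule: reval.induct)
  case (Zero xs)
  from at_body[OF Zero(2,1,3) refl] show ?case by simp
next
  case (Succ x)
  from at_body[OF Succ(2,1,3) refl] Succ(3) show ?case by (simp add: args_def)
next
  case (Proj i xs)
  from at_body[OF Proj(3,2,4) refl] Proj(1,4) show ?case by (simp add: args_def)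
next
  case (Comp ys gs xs f' z)
  let ?n = "length xs" and ?h = "ix (1, f', length gs)"
  note C = calls_Comp[OF at_calls[OF Comp.prems(2)]]
  have c: "\<And>g k. g \<in> set gs \<Longrightarrow> k < ?n \<Longrightarrow> V (ix (0, g, ?n) # \<pi>) (Suc k) = V \<pi> (Suc k)"
    "\<And>j. j < length gs \<Longrightarrow> V (?h # \<pi>) (Suc j) = V (ix (0, gs ! j, ?n) # \<pi>) 0"
    "V (?h # \<pi>) 0 = V \<pi> 0"
    using at_body[OF Comp.prems(2,1,3) refl] by (auto simp: Let_def)
  have "V (ix (0, gs ! j, ?n) # \<pi>) 0 = code (Some (ys ! j))" if j: "j < length gs" for j
  proof (rule Comp.IH(1)[OF j])
    show "at_call (ix (0, gs ! j, ?n) # \<pi>) (0, gs ! j, ?n)"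
      using j by (intro at_child[OF Comp.prems(2)] C) auto
    show "args (ix (0, gs ! j, ?n) # \<pi>) xs"
      using j Comp.prems(3) c(1) by (auto simp: args_def)
  qed simp
  then have "args (?h # \<pi>) ys" using c(2) Comp.hyps(1) by (simp add: args_def)
  moreover have "at_call (?h # \<pi>) (1, f', length ys)"
    unfolding Comp.hyps(1) by (intro at_child[OF Comp.prems(2)] C) simp
  ultimately have "V (?h # \<pi>) 0 = code (Some z)" by (intro Comp.IH(2)) auto
  with c(3) show ?case by simp
next
  case (PrimRec_0 f' xs y g)
  let ?b = "ix (0, f', length xs)"
  note A = PrimRec_0.prems(3)
  note C = calls_PrimRec[OF at_calls[OF PrimRec_0.prems(2)]]
  have c: "\<And>k. k < length xs \<Longrightarrow> V (?b # \<pi>) (Suc k) = V \<pi> (Suc (Suc k))" "V (?b # \<pi>) 0 = V \<pi> 0"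
    using at_body[OF PrimRec_0.prems(2,1,3) refl] A by (auto simp: Let_def args_Cons)
  have "V (?b # \<pi>) 0 = code (Some y)"
  proof (rule PrimRec_0.IH)
    show "at_call (?b # \<pi>) (0, f', length xs)" by (intro at_child[OF PrimRec_0.prems(2)] C) auto
    show "args (?b # \<pi>) xs" using c(1) A by (auto simp: args_def args_Cons)
  qed simp
  with c(2) show ?case by simp
next
  case (PrimRec_Suc f' g n xs y z)
  let ?m = "Suc (length xs)"
  let ?s = "ix (0, PrimRec f' g, ?m)" and ?h = "ix (1, g, Suc ?m)"
  note A = PrimRec_Suc.prems(3)
  note C = calls_PrimRec[OF at_calls[OF PrimRec_Suc.prems(2)]] calls_retag[OF at_calls[OF PrimRec_Suc.prems(2)]]
  \<comment> \<open>The code of \<open>Suc n\<close> is not \<open>1\<close>, which rules out the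
    base alternative of the recursion.\<close>
  have "(1 / 2 :: real) * (1 / 2) ^ n \<noteq> 1"
    using power_le_one[of "1 / 2 :: real" n] by simp
  then have c: "V (?s # \<pi>) 1 = 2 * V \<pi> 1" "\<And>k. k < length xs \<Longrightarrow> V (?s # \<pi>) (Suc (Suc k)) = V \<pi> (Suc (Suc k))"
    "V (?h # \<pi>) 1 = 2 * V \<pi> 1" "V (?h # \<pi>) 2 = V (?s # \<pi>) 0"
    "\<And>k. k < length xs \<Longrightarrow> V (?h # \<pi>) (Suc (Suc (Suc k))) = V \<pi> (Suc (Suc k))" "V (?h # \<pi>) 0 = V \<pi> 0"
    using at_body[OF PrimRec_Suc.prems(2,1,3) refl] A by (auto simp: Let_def args_Cons)
  have "V (?s # \<pi>) 0 = code (Some y)"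
  proof (rule PrimRec_Suc.IH(1))
    show "at_call (?s # \<pi>) (0, PrimRec f' g, length (n # xs))"
      using C(3)[of 0] by (auto intro!: at_child[OF PrimRec_Suc.prems(2)])
    show "args (?s # \<pi>) (n # xs)" using c(1,2) A by (auto simp: args_Cons)
  qed simp
  then have "args (?h # \<pi>) (n # y # xs)"
    using c(3-5) A by (auto simp: args_Cons args_def All_less_Suc2 numeral_2_eq_2)
  moreover have "at_call (?h # \<pi>) (1, g, length (n # y # xs))"
    using C(2)[of 1] by (auto intro!: at_child[OF PrimRec_Suc.prems(2)])
  ultimately have "V (?h # \<pi>) 0 = code (Some z)" by (intro PrimRec_Suc.IH(2)) auto
  with c(6) show ?case by simp
next
  case (Mu f' n xs)
  let ?m = "Suc (length xs)"
  let ?s = "ix (2, f', ?m)" and ?c = "ix (0, f', ?m)"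
  have calls: "(tag', f', ?m) \<in> calls f" if "tag' < 4" for tag'
    using calls_Mu[OF at_calls[OF Mu.prems(2)] that] by simp
  \<comment> \<open>Inner induction from the zero \<open>n\<close> down to the start: below
    \<open>n\<close> the tested values are positive, so each search node copies the result of the
    next one.\<close>
  have search: "V \<pi>' 0 = code (Some n)" if "i \<le> n" "at_call \<pi>' (2, f', ?m)" "args \<pi>' (i # xs)" for i \<pi>'
    using that
  proof (induction arbitrary: \<pi>' rule: inc_induct)
    case base
    have c: "\<And>k. k < ?m \<Longrightarrow> V (?c # \<pi>') (Suc k) = V \<pi>' (Suc k)"
      "V (?c # \<pi>') 0 = 0 \<or> V (?c # \<pi>') 0 = 1 \<and> V \<pi>' 0 = V \<pi>' 1 \<or> V (?c # \<pi>') 0 \<le> 1 / 2"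
      using at_search[OF base(1,2)] by (auto simp: search_con_def Let_def)
    have "V (?c # \<pi>') 0 = code (Some 0)"
    proof (rule Mu.IH(1))
      show "at_call (?c # \<pi>') (0, f', length (n # xs))"
        using at_child[OF base(1) calls[of 0]] by simp
      show "args (?c # \<pi>') (n # xs)" using c(1) base(2) by (simp add: args_def)
    qed simp
    with c(2) base(2) show ?case by (simp add: args_Cons)
  next
    case (step i)
    have c: "\<And>k. k < ?m \<Longrightarrow> V (?c # \<pi>') (Suc k) = V \<pi>' (Suc k)"
      "V (?c # \<pi>') 0 = 0 \<or> V (?c # \<pi>') 0 = 1 \<or>
        2 * V (?s # \<pi>') 1 = V \<pi>' 1 \<and> (\<forall>k<length xs. V (?s # \<pi>') (Suc (Suc k)) = V \<pi>' (Suc (Suc k))) \<and>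
        V (?s # \<pi>') 0 = V \<pi>' 0"
      using at_search[OF step.prems] by (auto simp: search_con_def Let_def)
    obtain y where y: "\<And>tag \<pi>. tag < 2 \<Longrightarrow> at_call \<pi> (tag, f', length (i # xs)) \<Longrightarrow> args \<pi> (i # xs) \<Longrightarrow>
        V \<pi> 0 = code (Some (Suc y))"
      using Mu.IH(2)[OF step.hyps(2)] by blast
    have "V (?c # \<pi>') 0 = code (Some (Suc y))"
    proof (rule y)
      show "at_call (?c # \<pi>') (0, f', length (i # xs))"
        using at_child[OF step.prems(1) calls[of 0]] by simp
      show "args (?c # \<pi>') (i # xs)" using c(1) step.prems(2) by (simp add: args_def)
    qed simp
    \<comment> \<open>The code of \<open>Suc y\<close> is neither \<open>0\<close> nor
      \<open>1\<close>, so only the third alternative of the search remains.\<close>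
    moreover have "(1 / 2 :: real) * (1 / 2) ^ y \<noteq> 1"
      using power_le_one[of "1 / 2 :: real" y] by simp
    ultimately have d: "2 * V (?s # \<pi>') 1 = V \<pi>' 1" "\<forall>k<length xs. V (?s # \<pi>') (Suc (Suc k)) = V \<pi>' (Suc (Suc k))"
        "V (?s # \<pi>') 0 = V \<pi>' 0"
      using c(2) by auto
    have "V (?s # \<pi>') 0 = code (Some n)"
    proof (rule step.IH)
      show "at_call (?s # \<pi>') (2, f', ?m)" by (rule at_child[OF step.prems(1) calls]) simp
      show "args (?s # \<pi>') (Suc i # xs)" using d step.prems(2) by (simp add: args_Cons)
    qed
    with d(3) show ?case by simp
  qed
  have c: "V (?s # \<pi>) 1 = 1" "\<And>k. k < length xs \<Longrightarrow> V (?s # \<pi>) (Suc (Suc k)) = V \<pi> (Suc k)"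
    "V (?s # \<pi>) 0 = V \<pi> 0"
    using at_body[OF Mu.prems(2,1,3) refl] by (auto simp: Let_def)
  have "V (?s # \<pi>) 0 = code (Some n)"
  proof (rule search)
    show "at_call (?s # \<pi>) (2, f', ?m)" by (rule at_child[OF Mu.prems(2) calls]) simp
    show "args (?s # \<pi>) (0 # xs)"
      unfolding args_Cons using c(1,2) Mu.prems(3) by (simp add: args_def)
  qed simp
  with c(3) show ?case by simp
qed

text \<open>The root forces the claimed result to be \<open>0\<close>, whereas the code of a defined
  value is positive.\<close>

lemma model_imp_undefined: "\<not> reval f [x] y"
proof
  assume ev: "reval f [x] y"
  let ?\<pi> = "[ix (0, f, 1)]"
  have root_at: "at_call [] (3, f, 1)" using ty_ix[OF calls_root[of 3]] by (simp add: at_call_def root_def)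
  have "2 ^ x * V ?\<pi> 1 = 1" "V ?\<pi> 0 = 0" using at_csat[OF root_at] by auto
  moreover have "at_call ?\<pi> (0, f, length [x])" using at_child[OF root_at calls_root[of 0]] by simp
  ultimately have "V ?\<pi> 0 = code (Some y)"
    by (intro model_sound[OF ev, of 0]) (auto simp: args_def power_one_over field_simps)
  with \<open>V ?\<pi> 0 = 0\<close> show False by simp
qed

end

section \<open>Completeness: the true semantics satisfies the constraints\<close>

text \<open>One level of the construction: \<open>cs\<close> chooses the arguments of the children,
  and \<open>sem\<close> then supplies all results.\<close>

lemma body_children:
  assumes t: "(tag, g, n) \<in> calls f" and tag: "tag < 2" and ns: "length ns = n"
  shows "\<exists>cs. (\<forall>t. length (cs t) = arity t) \<and>
    csat (slot_val (tag, g, n) (map Some ns)) (\<lambda>j. slot_val (ty j) (cs (ty j))) (body_con ix g n)"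
proof (cases g)
  case Zero
  have "sem (tag, Zero, n) (map Some ns) = Some 0"
    unfolding sem_eq_Some_iff using tag by (simp add: reval.Zero)
  then show ?thesis using Zero by (intro exI[of _ none_args]) simp
next
  case Succ
  have "2 * code (sem (tag, Succ, 1) (map Some ns)) = code (map Some ns ! 0)" if n1: "n = 1"
  proof -
    obtain a where a: "ns = [a]" using ns n1 by (auto simp: length_Suc_conv)
    have "sem (tag, Succ, 1) (map Some ns) = Some (Suc a)"
      unfolding sem_eq_Some_iff using tag a by (simp add: reval.Succ)
    then show ?thesis by (simp add: a)
  qed
  then show ?thesis using Succ ns by (intro exI[of _ none_args]) (auto simp: slot_val_def)
next
  case (Proj i)
  have "sem (tag, Proj i, n) (map Some ns) = Some (ns ! i)" if "i < n"
    unfolding sem_eq_Some_iff using tag that ns by (simp add: reval.Proj)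
  then show ?thesis using Proj ns by (intro exI[of _ none_args]) auto
next
  case (Comp h gs)
  note C = calls_Comp[OF t[unfolded Comp]]
  let ?h = "(1, h, length gs)"
  \<comment> \<open>The outer function receives the inner results. Every call with tag
    \<open>0\<close> and \<open>n\<close> arguments receives those of the node, which covers all
    inner functions at once.\<close>
  let ?cs = "\<lambda>t. if t = ?h then map (\<lambda>g. sem (0, g, n) (map Some ns)) gs
    else if fst t = 0 \<and> arity t = n then map Some ns else none_args t"
  have "ty (ix ?h) = ?h" "g \<in> set gs \<Longrightarrow> ty (ix (0, g, n)) = (0, g, n)" for g
    by (auto intro!: ty_ix C)
  then show ?thesis
    using ns sem_Comp[OF tag] by (intro exI[of _ ?cs]) (auto simp: Comp Let_def)
next
  case (PrimRec h g')
  note C = calls_PrimRec[OF t[unfolded PrimRec]] calls_retag[OF t[unfolded PrimRec]]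
  show ?thesis
  proof (cases ns)
    case Nil
    then show ?thesis using ns PrimRec by (intro exI[of _ none_args]) auto
  next
    case (Cons a r)
    let ?m = "length r"
    have n: "n = Suc ?m" using ns Cons by simp
    show ?thesis
    proof (cases a)
      case 0
      let ?b = "(0, h, ?m)"
      let ?cs = "none_args(?b := map Some r)"
      have "ty (ix ?b) = ?b" using n by (intro ty_ix C) auto
      moreover have "sem ?b (map Some r) = sem (tag, PrimRec h g', n) (map Some ns)"
        using tag by (intro sem_eqI) (simp add: Cons 0 reval_PrimRec_0_iff)
      ultimately show ?thesis
        using Cons 0 n by (intro exI[of _ ?cs]) (auto simp: PrimRec Let_def)
    next
      case (Suc b)
      let ?s = "(0, PrimRec h g', n)" and ?h = "(1, g', Suc n)"
      \<comment> \<open>Both children receive the predecessor \<open>b\<close>; the step function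
        also receives the recursive result, which may be undefined.\<close>
      let ?cs = "none_args(?s := map Some (b # r), ?h := Some b # sem ?s (map Some (b # r)) # map Some r)"
      have "ty (ix ?s) = ?s" "ty (ix ?h) = ?h" by (auto intro!: ty_ix C)
      moreover have "(1 / 2 :: real) ^ b \<le> 1" by (simp add: power_le_one)
      ultimately show ?thesis
        using Cons Suc n sem_PrimRec_Suc[OF tag, of g' "Suc n" b h n r n]
        by (intro exI[of _ ?cs]) (auto simp: PrimRec Let_def numeral_2_eq_2)
    qed
  qed
next
  case (Mu h)
  let ?s = "(2, h, Suc n)"
  let ?cs = "none_args(?s := map Some (0 # ns))"
  have "ty (ix ?s) = ?s" by (intro ty_ix calls_Mu[OF t[unfolded Mu]]) simp
  moreover have "sem ?s (map Some (0 # ns)) = sem (tag, Mu h, n) (map Some ns)"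
    using tag by (intro sem_eqI) (simp add: reval_Mu_iff)
  ultimately show ?thesis
    using ns by (intro exI[of _ ?cs]) (auto simp: Mu Let_def)
qed

lemma search_children:
  assumes t: "(2, g, n) \<in> calls f" and ns: "length ns = n"
  shows "\<exists>cs. (\<forall>t. length (cs t) = arity t) \<and>
    csat (slot_val (2, g, n) (map Some ns)) (\<lambda>j. slot_val (ty j) (cs (ty j))) (search_con ix g n)"
proof (cases ns)
  case Nil
  then show ?thesis using ns by (intro exI[of _ none_args]) (auto simp: search_con_def)
next
  case (Cons a r)
  let ?c = "(0, g, n)" and ?s = "(2, g, n)"
  let ?cs = "none_args(?c := map Some ns, ?s := map Some (Suc a # r))"
  have n: "n = Suc (length r)" using ns Cons by simp
  have ty: "ty (ix ?c) = ?c" "ty (ix ?s) = ?s" using calls_retag[OF t] by (auto intro!: ty_ix)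
  have "code (sem ?c (map Some ns)) = 0 \<or>
    code (sem ?c (map Some ns)) = 1 \<and> sem ?s (map Some ns) = Some a \<or>
    code (sem ?c (map Some ns)) \<le> 1 / 2 \<and> sem ?s (map Some (Suc a # r)) = sem ?s (map Some ns)"
  proof (cases "sem ?c (map Some ns)")
    case (Some y)
    then have ev: "reval g (a # r) y" using sem_eq_Some_iff[of ?c "a # r" y] by (simp add: Cons)
    show ?thesis
    proof (cases y)
      case 0
      then have "sem ?s (map Some ns) = Some a"
        unfolding sem_eq_Some_iff using mu_from_0[of g a r a] ev by (simp add: Cons)
      then show ?thesis using Some 0 by simp
    next
      case (Suc z)
      have "sem ?s (map Some (Suc a # r)) = sem ?s (map Some ns)"
        using mu_from_Suc[of g a r z] ev Suc by (intro sem_eqI) (simp add: Cons)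
      moreover have "code (Some y) \<le> 1 / 2" using Suc by (simp add: power_le_one)
      ultimately show ?thesis using Some by simp
    qed
  qed simp
  then show ?thesis
    using Cons ty n by (intro exI[of _ ?cs]) (auto simp: search_con_def Let_def)
qed

text \<open>Divergence of \<open>f\<close> at \<open>x\<close> enters only at the root, whose child
  must have an undefined result. Elsewhere an undefined argument satisfies the guard, and defined
  arguments fall under the two preceding lemmas.\<close>

lemma call_children:
  assumes undef: "\<And>y. \<not> reval f [x] y" and t: "t \<in> calls f" and as: "length as = arity t"
  shows "\<exists>cs. (\<forall>t. length (cs t) = arity t) \<and>
    csat (slot_val t as) (\<lambda>j. slot_val (ty j) (cs (ty j))) (call_con ix f x t)"
proof -
  obtain tag g n where t': "t = (tag, g, n)" by (cases t)
  have n: "length as = n" using as t' by simp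
  show ?thesis
  proof (cases "tag = 3")
    case True
    let ?c = "(0, f, 1)"
    let ?cs = "none_args(?c := map Some [x])"
    have "ty (ix ?c) = ?c" by (intro ty_ix calls_root) simp
    moreover have "sem ?c (map Some [x]) \<noteq> Some y" for y
      unfolding sem_eq_Some_iff using undef by simp
    then have "sem ?c [Some x] = None" by auto
    ultimately show ?thesis
      using True t' by (intro exI[of _ ?cs]) (auto simp: slot_val_def power_one_over)
  next
    case tag: False
    show ?thesis
    proof (cases "None \<in> set as")
      case True
      then obtain k where "k < n" "as ! k = None" using n by (auto simp: in_set_conv_nth)
      then have "\<exists>k\<in>{0..<n}. code (as ! k) = 0" by force
      then show ?thesis
        using tag t' n by (intro exI[of _ none_args]) (auto simp: guard_con_def)
    next
      case False
      then obtain ns where ns: "as = map Some ns" using not_None_imp_map_Some by blast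
      have tag4: "tag < 4" using t t' by (simp add: calls_def)
      show ?thesis
      proof (cases "tag = 2")
        case True
        then show ?thesis
          using search_children[of g n ns] t t' n ns by (auto simp: guard_con_def)
      next
        case False
        then have "tag < 2" using tag tag4 by simp
        then show ?thesis
          using body_children[of tag g n ns] t t' n ns by (auto simp: guard_con_def)
      qed
    qed
  qed
qed

lemma undefined_imp_model:
  assumes undef: "\<And>y. \<not> reval f [x] y"
  shows "\<exists>V. tree_model N root (\<lambda>j. call_con ix f x (ty j)) V"
proof -
  obtain ch where ch: "\<And>t as t'. t \<in> calls f \<Longrightarrow> length as = arity t \<Longrightarrow> length (ch t as t') = arity t'"
    "\<And>t as. t \<in> calls f \<Longrightarrow> length as = arity t \<Longrightarrow>
      csat (slot_val t as) (\<lambda>j. slot_val (ty j) (ch t as (ty j))) (call_con ix f x t)"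
    using call_children[OF undef] by metis
  define call_at where "call_at \<pi> = ty (hd (\<pi> @ [root]))" for \<pi>
  \<comment> \<open>Arguments are chosen from the root downwards: positions list the innermost type
    first, so recursion on the list passes from a node to its children.\<close>
  define st where "st = rec_list (none_args (ty root)) (\<lambda>j \<pi> as. ch (call_at \<pi>) as (ty j))"
  have st: "st [] = none_args (ty root)" "st (j # \<pi>) = ch (call_at \<pi>) (st \<pi>) (ty j)" for j \<pi>
    by (simp_all add: st_def)
  have call_at: "call_at \<pi> \<in> calls f" if "set \<pi> \<subseteq> {..<N}" for \<pi>
    using that ty_calls[OF root_less] ty_calls by (cases \<pi>) (auto simp: call_at_def)
  have len: "length (st \<pi>) = arity (call_at \<pi>)" if "set \<pi> \<subseteq> {..<N}" for \<pi>
    using that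
  proof (induction \<pi>)
    case (Cons j \<pi>)
    then show ?case using ch(1)[OF call_at[of \<pi>]] by (simp add: st call_at_def)
  qed (simp add: st call_at_def)
  have "tree_model N root (\<lambda>j. call_con ix f x (ty j)) (\<lambda>\<pi>. slot_val (call_at \<pi>) (st \<pi>))"
    unfolding tree_model_def
  proof (intro allI impI conjI)
    fix \<pi> assume \<pi>: "set \<pi> \<subseteq> {..<N}"
    have "csat (slot_val (call_at \<pi>) (st \<pi>)) (\<lambda>j. slot_val (ty j) (st (j # \<pi>))) (call_con ix f x (call_at \<pi>))"
      unfolding st by (rule ch(2)[OF call_at[OF \<pi>] len[OF \<pi>]])
    then show "csat (slot_val (call_at \<pi>) (st \<pi>)) (\<lambda>t. slot_val (call_at (t # \<pi>)) (st (t # \<pi>)))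
        (call_con ix f x (ty (hd (\<pi> @ [root]))))"
      by (simp add: call_at_def)
  qed (simp_all add: slot_val_def code_bounds)
  then show ?thesis by blast
qed

theorem undefined_iff_model:
  "(\<nexists>y. reval f [x] y) \<longleftrightarrow> (\<exists>V. tree_model N root (\<lambda>j. call_con ix f x (ty j)) V)"
  using model_imp_undefined undefined_imp_model by blast

end

section \<open>Computability of the reduction\<close>

definition computable2 :: "(nat \<Rightarrow> nat \<Rightarrow> nat) \<Rightarrow> bool" where
  "computable2 h \<longleftrightarrow> (\<exists>f. \<forall>x y. reval f [x, y] (h x y))"

lemma reval_Comp1: "reval g xs y \<Longrightarrow> reval f [y] z \<Longrightarrow> reval (Comp f [g]) xs z"
  by (rule reval.Comp[where ys = "[y]"]) auto

lemma reval_Comp2: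
  "reval g xs y \<Longrightarrow> reval g' xs y' \<Longrightarrow> reval f [y, y'] z \<Longrightarrow> reval (Comp f [g, g']) xs z"
  by (rule reval.Comp[where ys = "[y, y']"]) (auto simp: less_Suc_eq nth_Cons')

lemma reval_Proj: "i < length xs \<Longrightarrow> xs ! i = y \<Longrightarrow> reval (Proj i) xs y"
  using reval.Proj by blast

lemma total_computable_id: "total_computable (\<lambda>x. x)"
  unfolding total_computable_def by (intro exI[of _ "Proj 0"] allI reval_Proj) auto

lemma total_computable_Suc: "total_computable h \<Longrightarrow> total_computable (\<lambda>x. Suc (h x))"
  unfolding total_computable_def by (blast intro: reval_Comp1 reval.Succ)

lemma total_computable_const: "total_computable (\<lambda>_. c)"
proof (induction c)
  case 0
  then show ?case unfolding total_computable_def using reval.Zero by blast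
qed (rule total_computable_Suc)

lemma total_computable_comp:
  "total_computable f \<Longrightarrow> total_computable g \<Longrightarrow> total_computable (\<lambda>x. f (g x))"
  unfolding total_computable_def by (blast intro: reval_Comp1)

lemma total_computable_comp2:
  "computable2 f \<Longrightarrow> total_computable g \<Longrightarrow> total_computable h \<Longrightarrow> total_computable (\<lambda>x. f (g x) (h x))"
  unfolding total_computable_def computable2_def by (blast intro: reval_Comp2)

lemma computable2_primrec:
  assumes "total_computable f" and "computable2 g"
    and "\<And>y. h 0 y = f y" and "\<And>n y. h (Suc n) y = g (h n y) y"
  shows "computable2 h"
proof -
  obtain rf rg where rf: "\<And>x. reval rf [x] (f x)" and rg: "\<And>x y. reval rg [x, y] (g x y)"
    using assms(1,2) unfolding total_computable_def computable2_def by blast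
  let ?g = "Comp rg [Proj 1, Proj 2]"
  have step: "reval ?g [n, z, y] (g z y)" for n z y
    by (rule reval_Comp2[OF reval_Proj reval_Proj rg]) auto
  have "reval (PrimRec rf ?g) [n, y] (h n y)" for n y
    by (induction n) (use rf step assms(3,4) in \<open>auto intro: reval.intros(5,6)\<close>)
  then show ?thesis unfolding computable2_def by blast
qed

lemma total_computable_primrec:
  assumes "computable2 g" and "\<And>n. h (Suc n) = g n (h n)"
  shows "total_computable h"
proof -
  obtain rf rg where rf: "\<And>x. reval rf [x] (h 0)" and rg: "\<And>x y. reval rg [x, y] (g x y)"
    using assms(1) total_computable_const[of "h 0"] unfolding total_computable_def computable2_def by blast
  let ?g = "Comp rg [Proj 0, Proj 1]"
  have step: "reval ?g [n, z, y] (g n z)" for n z y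
    by (rule reval_Comp2[OF reval_Proj reval_Proj rg]) auto
  have P: "reval (PrimRec rf ?g) [n, m] (h n)" for n m
    by (induction n) (use rf step assms(2) in \<open>auto intro: reval.intros(5,6)\<close>)
  \<comment> \<open>The counter is repeated as a dummy parameter, because the base function
    \<open>rf\<close> expects one argument.\<close>
  have "reval (Comp (PrimRec rf ?g) [Proj 0, Proj 0]) [n] (h n)" for n
    by (rule reval_Comp2[OF reval_Proj reval_Proj P]) auto
  then show ?thesis unfolding total_computable_def by blast
qed

lemma computable2_fst: "computable2 (\<lambda>x y. x)"
  unfolding computable2_def by (intro exI[of _ "Proj 0"] allI reval_Proj) auto

lemma computable2_snd: "computable2 (\<lambda>x y. y)"
  unfolding computable2_def by (intro exI[of _ "Proj 1"] allI reval_Proj) auto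

lemma computable2_comp:
  "total_computable f \<Longrightarrow> computable2 g \<Longrightarrow> computable2 (\<lambda>x y. f (g x y))"
  unfolding total_computable_def computable2_def by (blast intro: reval_Comp1)

lemma computable2_comp2:
  assumes "computable2 f" "computable2 g" "computable2 h"
  shows "computable2 (\<lambda>x y. f (g x y) (h x y))"
proof -
  obtain rf rg rh where r: "\<And>x y. reval rf [x, y] (f x y)" "\<And>x y. reval rg [x, y] (g x y)"
    "\<And>x y. reval rh [x, y] (h x y)"
    using assms unfolding computable2_def by blast
  have "reval (Comp rf [rg, rh]) [x, y] (f (g x y) (h x y))" for x y
    by (rule reval_Comp2[OF r(2,3,1)])
  then show ?thesis unfolding computable2_def by blast
qed

lemma computable2_add: "computable2 (+)"
  by (rule computable2_primrec[OF total_computable_id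
        computable2_comp[OF total_computable_Suc[OF total_computable_id] computable2_fst]]) auto

lemma computable2_mult: "computable2 (*)"
  by (rule computable2_primrec[OF total_computable_const[of 0] computable2_add]) auto

lemma total_computable_triangle: "total_computable triangle"
  by (rule total_computable_primrec[OF computable2_comp[OF total_computable_Suc[OF total_computable_id] computable2_add]]) auto

lemma total_computable_power2: "total_computable (\<lambda>x. 2 ^ x)"
  by (rule total_computable_primrec[OF computable2_comp2[OF computable2_add computable2_snd computable2_snd]]) auto

lemma total_computable_pred: "total_computable (\<lambda>x. x - 1)"
  by (rule total_computable_primrec[OF computable2_fst]) auto

lemma total_computable_prod_encode:
  assumes f: "total_computable f" and g: "total_computable g"
  shows "total_computable (\<lambda>x. prod_encode (f x, g x))"
  unfolding prod_encode_def split
  by (rule total_computable_comp2[OF computable2_add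
        total_computable_comp[OF total_computable_triangle total_computable_comp2[OF computable2_add f g]] f])

lemma total_computable_list_encode_Cons:
  assumes "total_computable f" "total_computable (\<lambda>x. list_encode (g x))"
  shows "total_computable (\<lambda>x. list_encode (f x # g x))"
  unfolding list_encode.simps by (rule total_computable_Suc[OF total_computable_prod_encode[OF assms]])

text \<open>\<open>int_encode\<close> sends a natural number \<open>k\<close> to
  \<open>2 * k\<close>, and \<open>- k\<close> for positive \<open>k\<close> to
  \<open>2 * k - 1\<close>.\<close>

lemma total_computable_int_encode_mult_power2:
  "total_computable (\<lambda>x. int_encode (c * 2 ^ x))"
proof -
  have 1: "total_computable (\<lambda>x. 2 * (m * 2 ^ x))" for m
    by (intro total_computable_comp2[OF computable2_mult] total_computable_const total_computable_power2)
  show ?thesis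
  proof (cases "c \<ge> 0")
    case True
    then have "int_encode (c * 2 ^ x) = 2 * (nat c * 2 ^ x)" for x
      by (auto simp: int_encode_def sum_encode_def nat_mult_distrib nat_power_eq)
    with 1[of "nat c"] show ?thesis by simp
  next
    case False
    then obtain d where d: "c = - int (Suc d)" by (metis int_cases linear of_nat_0_le_iff)
    have "int_encode (c * 2 ^ x) = 2 * (Suc d * 2 ^ x) - 1" for x
    proof -
      have "Suc d * 2 ^ x > 0" by simp
      then obtain e where e: "Suc d * 2 ^ x = Suc e" by (metis Suc_pred)
      have "c * 2 ^ x = - int (Suc d * 2 ^ x)" 
        by (simp only: d of_nat_mult of_nat_power of_nat_numeral minus_mult_left)
      also have "\<dots> = - int (Suc e)" by (simp only: e)
      finally show ?thesis unfolding e by (simp add: int_encode_def sum_encode_def)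
    qed
    with total_computable_comp[OF total_computable_pred 1[of "Suc d"]] show ?thesis by simp
  qed
qed

section \<open>Computable families of formulas\<close>

definition computable_formula :: "(nat \<Rightarrow> nat sformula) \<Rightarrow> bool" where
  "computable_formula F \<longleftrightarrow> total_computable (\<lambda>x. encode_sformula (F x))"

lemma computable_formula_const: "computable_formula (\<lambda>_. \<Phi>)"
  unfolding computable_formula_def by (rule total_computable_const)

lemma computable_formula_Conj:
  "computable_formula F \<Longrightarrow> computable_formula G \<Longrightarrow> computable_formula (\<lambda>x. Conj (F x) (G x))"
  unfolding computable_formula_def encode_sformula.simps
  by (intro total_computable_list_encode_Cons total_computable_const)

lemma computable_formula_Disj:
  "computable_formula F \<Longrightarrow> computable_formula G \<Longrightarrow> computable_formula (\<lambda>x. Disj (F x) (G x))"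
  unfolding computable_formula_def encode_sformula.simps
  by (intro total_computable_list_encode_Cons total_computable_const)

text \<open>This is the only shape in which the input enters a formula of the reduction.\<close>

lemma computable_formula_Prob_power2:
  "computable_formula (\<lambda>x. Prob [(c * 2 ^ x, \<phi>)] r d)"
  unfolding computable_formula_def encode_sformula.simps list.map split
  by (intro total_computable_list_encode_Cons total_computable_const total_computable_prod_encode
      total_computable_int_encode_mult_power2)

lemma computable_formula_foldr_Conj:
  assumes "\<And>t. t \<in> set ts \<Longrightarrow> computable_formula (\<lambda>x. F x t)"
  shows "computable_formula (\<lambda>x. foldr (\<lambda>t. Conj (F x t)) ts \<Phi>)"
  using assms
proof (induction ts)
  case Nil
  then show ?case by (simp add: computable_formula_const)
next
  case (Cons t ts)
  then show ?case by (simp add: computable_formula_Conj)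
qed

lemma (in tree_mdp) computable_call_con: "computable_formula (\<lambda>x. con_formula j (call_con ix f x t))"
proof -
  obtain tag g n where t: "t = (tag, g, n)" by (cases t)
  \<comment> \<open>The scaling of child slots by the square of \<open>N + K\<close> is absorbed
    into the constant factor of the power of two.\<close>
  have Lin: "computable_formula (\<lambda>x. con_formula j (Lin [(b * 2 ^ x, Chd k i)] d))" for b k i d
    using computable_formula_Prob_power2[of "b * int ((N + K)\<^sup>2)"] by (simp add: mult_ac)
  have "computable_formula (\<lambda>x. con_formula j (const_con (2 ^ x) (Chd k i) d))" for k i d
    unfolding const_con_def con_formula.simps(2)
    using Lin[of 1 k i d] Lin[of "- 1" k i "- d"] by (intro computable_formula_Conj) simp_all
  then show ?thesis
    by (cases "tag = 3") (auto simp: t intro!: computable_formula_Conj computable_formula_const)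
qed

lemma (in tree_mdp) total_computable_instance:
  "total_computable (\<lambda>x. encode_instance M (tree_formula (\<lambda>j. call_con ix f x (ty j))))"
proof -
  have "computable_formula (\<lambda>x. tree_formula (\<lambda>j. call_con ix f x (ty j)))"
    unfolding tree_formula_def
    by (intro computable_formula_foldr_Conj computable_formula_Disj computable_formula_const computable_call_con)
  then show ?thesis
    unfolding encode_instance_def computable_formula_def
    by (intro total_computable_prod_encode total_computable_const)
qed

theorem theorem35:
  shows "coRE_hard
    {encode_instance M \<Phi> | (M :: (nat, nat, nat) mdp) (\<Phi> :: nat sformula).
       standard_mdp M \<and> wf_sformula \<Phi> \<and> atoms \<Phi> \<subseteq> AP M \<and>
       window \<Phi> \<and> flat_formula \<Phi> \<and> non_strict \<Phi> \<and>
       (\<exists>\<sigma>. is_strategy M \<sigma> \<and> mc_sat_AG (induced_mc M \<sigma>) \<Phi>)}"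
  unfolding coRE_hard_def
proof (intro allI impI)
  fix A :: "nat set"
  assume "coRE A"
  then obtain f where "- A = {x. \<exists>y. reval f [x] y}" by (auto simp: coRE_def RE_def)
  then have A: "x \<in> A \<longleftrightarrow> (\<nexists>y. reval f [x] y)" for x by blast
  define N where "N = card (calls f)"
  obtain ty where ty: "bij_betw ty {0..<N} (calls f)"
    unfolding N_def using ex_bij_betw_nat_finite[OF finite_calls] by blast
  define ix where "ix = inv_into {0..<N} ty"
  interpret call_tree f ty ix N
  proof
    show "ty j \<in> calls f" if "j < N" for j
      using bij_betwE[OF ty] that by simp
    show "ix t < N" "ty (ix t) = t" if "t \<in> calls f" for t
      using bij_betw_inv_into_right[OF ty that] bij_betwE[OF bij_betw_inv_into[OF ty]] that
      by (auto simp: ix_def)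
  qed
  \<comment> \<open>One slot more than the largest arity, to hold the result.\<close>
  define K where "K = Suc (Max (arity ` calls f))"
  have "arity t < K" if "t \<in> calls f" for t
    unfolding K_def less_Suc_eq_le using that finite_calls by (intro Max_ge) auto
  then have ok: "con_ok N K (call_con ix f x (ty j))" if "j < N" for x j
    using that by (intro con_ok_call_con ty_calls)
  interpret T: tree_mdp N K root
    by standard (rule root_less)
  let ?h = "\<lambda>x. encode_instance T.M (T.tree_formula (\<lambda>j. call_con ix f x (ty j)))"
  show "many_one_reducible A
    {encode_instance M \<Phi> | (M :: (nat, nat, nat) mdp) (\<Phi> :: nat sformula).
       standard_mdp M \<and> wf_sformula \<Phi> \<and> atoms \<Phi> \<subseteq> AP M \<and>
       window \<Phi> \<and> flat_formula \<Phi> \<and> non_strict \<Phi> \<and>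
       (\<exists>\<sigma>. is_strategy M \<sigma> \<and> mc_sat_AG (induced_mc M \<sigma>) \<Phi>)}"
    unfolding many_one_reducible_def
  proof (intro exI[of _ ?h] conjI allI)
    show "total_computable ?h" by (rule T.total_computable_instance)
    fix x
    show "x \<in> A \<longleftrightarrow> ?h x \<in>
      {encode_instance M \<Phi> | (M :: (nat, nat, nat) mdp) (\<Phi> :: nat sformula).
         standard_mdp M \<and> wf_sformula \<Phi> \<and> atoms \<Phi> \<subseteq> AP M \<and>
         window \<Phi> \<and> flat_formula \<Phi> \<and> non_strict \<Phi> \<and>
         (\<exists>\<sigma>. is_strategy M \<sigma> \<and> mc_sat_AG (induced_mc M \<sigma>) \<Phi>)}"
      unfolding A undefined_iff_model by (rule T.instance_iff_tree_model[OF ok, symmetric])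
  qed
qed

end
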